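(* Let $q\ge 3$ be a prime power and let $X\subset\mathbb{P}^3(\mathbb{F}_q)$ be a hyperbolic quadric. The minimum weight codewords of $C_2(X)$ correspond to the quadrics of the following types, i.e. a codeword of $C_2(X)$ has minimum weight if and only if it equals $c(f)$ for some form $f$ of degree 2 such that $Z(f)$ is one of the following: (1) a union of two distinct tangent planes to $X$ such that the line of intersection of the two planes intersects $X$ at two points; (2) a hyperbolic quadric containing exactly four lines of $X$, with two lines in each regulus of $X$.
   Context: A quadric in $\mathbb{P}^3(\mathbb{F}_q)$ is the zero set $Z(f)$ of a nonzero form $f$ of degree 2 in $x_0,\dots,x_3$ over $\mathbb{F}_q$. It is non-degenerate if it has rank 4, the rank being the smallest number of indeterminates appearing in $f$ under any linear change of coordinates. A hyperbolic quadric is a non-degenerate quadric with $(q+1)^2$ points over $\mathbb{F}_q$. A regulus is the set of transversals of three pairwise skew lines in $\mathbb{P}^3(\mathbb{F}_q)$; it consists of $q+1$ pairwise skew lines. A hyperbolic quadric is a pair of complementary reguli $\mathcal{R}_1\cup\mathcal{R}_2$, each of which covers the quadric, and the lines of these two reguli are all the lines contained in it. A tangent plane to $X$ is a plane meeting $X$ in a degenerate plane quadric (of rank 2); here it is the union of the two lines of $X$ through a point of $X$. Let $F$ be the $\mathbb{F}_q$-vector space of forms of degree 2 in $x_0,\dots,x_3$ over $\mathbb{F}_q$ (including $0$). Each point $x\in\mathbb{P}^3(\mathbb{F}_q)$ is represented by its unique homogeneous coordinate vector whose first nonzero coordinate equals $1$. The functional code $C_2(X)$ is the image of the linear map $c:F\to\mathbb{F}_q^{|X|}$,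 $c(f)=(f(x_0,\dots,x_3))_{x\in X}$. The weight of a codeword is its number of nonzero coordinates; the minimum weight is the smallest nonzero weight. *)

theory Defs
  imports "HOL-Analysis.Analysis" "HOL-Library.Poly_Mapping"
begin

text \<open>
  Polynomials over \<open>'a\<close> in indeterminates indexed by the finite type \<open>'n\<close>: exponent vectors
  (monomials) mapped to coefficients. The four coordinates of projective 3-space are indexed by
  the numeral type \<open>4\<close>, whose elements are ordered \<open>0 < 1 < 2 < 3\<close>.
\<close>

type_synonym ('n, 'a) polyn = "('n \<Rightarrow>\<^sub>0 nat) \<Rightarrow>\<^sub>0 'a"

definition quadratic_forms :: "('n::finite, 'a::comm_ring_1) polyn set" where
  "quadratic_forms =
     {f. \<forall>m \<in> Poly_Mapping.keys f. (\<Sum>i\<in>UNIV. Poly_Mapping.lookup m i) = 2}"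

definition eval_poly :: "('n::finite, 'a::comm_ring_1) polyn \<Rightarrow> 'a ^ 'n \<Rightarrow> 'a" where
  "eval_poly f x =
     (\<Sum>m\<in>Poly_Mapping.keys f.
        Poly_Mapping.lookup f m * (\<Prod>i\<in>UNIV. (x $ i) ^ Poly_Mapping.lookup m i))"

definition subst_poly ::
    "('n \<Rightarrow> ('k, 'a) polyn) \<Rightarrow> ('n::finite, 'a::comm_ring_1) polyn \<Rightarrow> ('k::finite, 'a) polyn" where
  "subst_poly p f =
     (\<Sum>m\<in>Poly_Mapping.keys f.
        Poly_Mapping.single 0 (Poly_Mapping.lookup f m) *
        (\<Prod>i\<in>UNIV. p i ^ Poly_Mapping.lookup m i))"

definition linear_subst ::
    "'a ^ 'k ^ 'n \<Rightarrow> ('n::finite, 'a::comm_ring_1) polyn \<Rightarrow> ('k::finite, 'a) polyn" where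
  "linear_subst A =
     subst_poly (\<lambda>i. \<Sum>j\<in>UNIV. Poly_Mapping.single (Poly_Mapping.single j 1) (A $ i $ j))"

definition indeterminates :: "('n::finite, 'a::comm_ring_1) polyn \<Rightarrow> 'n set" where
  "indeterminates f = (\<Union>m\<in>Poly_Mapping.keys f. Poly_Mapping.keys m)"

definition form_rank :: "('n::finite, 'a::field) polyn \<Rightarrow> nat" where
  "form_rank f =
     (LEAST r. \<exists>A :: 'a ^ 'n ^ 'n. invertible A \<and> r = card (indeterminates (linear_subst A f)))"

text \<open>
  Each point of projective 3-space is represented by its coordinate vector whose first nonzero
  coordinate is 1; lines, planes and quadrics are sets of such vectors.
\<close>

definition points :: "('a::field ^ 4) set" where
  "points = {x. \<exists>i. x $ i = 1 \<and> (\<forall>j<i. x $ j = 0)}"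

definition proj_lines :: "('a::field ^ 4) set set" where
  "proj_lines = {points \<inter> S | S. vec.subspace S \<and> vec.dim S = 2}"

definition proj_planes :: "('a::field ^ 4) set set" where
  "proj_planes = {points \<inter> S | S. vec.subspace S \<and> vec.dim S = 3}"

definition zero_set :: "(4, 'a::field) polyn \<Rightarrow> ('a ^ 4) set" where
  "zero_set f = {x \<in> points. eval_poly f x = 0}"

definition hyperbolic_quadric :: "('a::{field,finite} ^ 4) set \<Rightarrow> bool" where
  "hyperbolic_quadric X \<longleftrightarrow>
     (\<exists>f \<in> quadratic_forms. f \<noteq> 0 \<and> form_rank f = 4 \<and> X = zero_set f) \<and>
     card X = (CARD('a) + 1)\<^sup>2"

definition regulus :: "('a::field ^ 4) set set \<Rightarrow> bool" where
  "regulus R \<longleftrightarrow>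
     (\<exists>l\<^sub>1 \<in> proj_lines. \<exists>l\<^sub>2 \<in> proj_lines. \<exists>l\<^sub>3 \<in> proj_lines.
        l\<^sub>1 \<inter> l\<^sub>2 = {} \<and> l\<^sub>1 \<inter> l\<^sub>3 = {} \<and> l\<^sub>2 \<inter> l\<^sub>3 = {} \<and>
        R = {t \<in> proj_lines. t \<inter> l\<^sub>1 \<noteq> {} \<and> t \<inter> l\<^sub>2 \<noteq> {} \<and> t \<inter> l\<^sub>3 \<noteq> {}})"

definition reguli_of ::
    "('a::field ^ 4) set \<Rightarrow> ('a ^ 4) set set \<Rightarrow> ('a ^ 4) set set \<Rightarrow> bool" where
  "reguli_of X R\<^sub>1 R\<^sub>2 \<longleftrightarrow>
     regulus R\<^sub>1 \<and> regulus R\<^sub>2 \<and> R\<^sub>1 \<inter> R\<^sub>2 = {} \<and> \<Union>R\<^sub>1 = X \<and> \<Union>R\<^sub>2 = X \<and>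
     R\<^sub>1 \<union> R\<^sub>2 = {l \<in> proj_lines. l \<subseteq> X}"

text \<open>
  The columns of \<open>B\<close> are a basis of the 3-dimensional subspace underlying the plane \<open>P\<close>, so
  \<open>B\<close> puts homogeneous coordinates on \<open>P\<close>, and \<open>g\<close> is an equation of \<open>P \<inter> X\<close> as a plane quadric
  in these coordinates.
\<close>

definition tangent_plane :: "('a::field ^ 4) set \<Rightarrow> ('a ^ 4) set \<Rightarrow> bool" where
  "tangent_plane X P \<longleftrightarrow>
     P \<in> proj_planes \<and>
     (\<exists>(B :: 'a ^ 3 ^ 4) (g :: (3, 'a) polyn).
        inj ((*v) B) \<and> P = points \<inter> range ((*v) B) \<and>
        g \<in> quadratic_forms \<and> g \<noteq> 0 \<and> form_rank g = 2 \<and>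
        P \<inter> X = {B *v y | y. B *v y \<in> points \<and> eval_poly g y = 0})"

text \<open>
  A vector indexed by the points of \<open>X\<close> is a function that is \<open>undefined\<close> outside \<open>X\<close>.
\<close>

definition codeword :: "('a::field ^ 4) set \<Rightarrow> (4, 'a) polyn \<Rightarrow> 'a ^ 4 \<Rightarrow> 'a" where
  "codeword X f = restrict (eval_poly f) X"

definition functional_code :: "('a::field ^ 4) set \<Rightarrow> ('a ^ 4 \<Rightarrow> 'a) set" where
  "functional_code X = codeword X ` quadratic_forms"

definition weight :: "('a::field ^ 4) set \<Rightarrow> ('a ^ 4 \<Rightarrow> 'a) \<Rightarrow> nat" where
  "weight X w = card {x \<in> X. w x \<noteq> 0}"

definition min_weight :: "('a::field ^ 4) set \<Rightarrow> nat" where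
  "min_weight X = (LEAST d. d \<noteq> 0 \<and> (\<exists>w \<in> functional_code X. weight X w = d))"

definition two_tangent_planes :: "('a::field ^ 4) set \<Rightarrow> ('a ^ 4) set \<Rightarrow> bool" where
  "two_tangent_planes X Y \<longleftrightarrow>
     (\<exists>P\<^sub>1 P\<^sub>2. tangent_plane X P\<^sub>1 \<and> tangent_plane X P\<^sub>2 \<and> P\<^sub>1 \<noteq> P\<^sub>2 \<and>
        Y = P\<^sub>1 \<union> P\<^sub>2 \<and> card (P\<^sub>1 \<inter> P\<^sub>2 \<inter> X) = 2)"

definition hyperbolic_four_lines :: "('a::{field,finite} ^ 4) set \<Rightarrow> ('a ^ 4) set \<Rightarrow> bool" where
  "hyperbolic_four_lines X Y \<longleftrightarrow>
     hyperbolic_quadric Y \<and>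
     card {l \<in> proj_lines. l \<subseteq> X \<and> l \<subseteq> Y} = 4 \<and>
     (\<exists>R\<^sub>1 R\<^sub>2. reguli_of X R\<^sub>1 R\<^sub>2 \<and>
        card {l \<in> R\<^sub>1. l \<subseteq> Y} = 2 \<and> card {l \<in> R\<^sub>2. l \<subseteq> Y} = 2)"

end

theory Submission
  imports Defs
begin

text \<open>
  A count of isotropic points excludes an elliptic form, so \<open>X\<close> has an equation
  \<open>x\<^sub>1 x\<^sub>4 = x\<^sub>2 x\<^sub>3\<close> in a suitable basis and is parametrised by pairs of points of the projective
  line (Segre map). A quadratic form restricted to a line of \<open>X\<close> has at most two zeros unless it
  vanishes there, so in the \<open>(q + 1) \<times> (q + 1)\<close> grid every row and every column that meets the
  support of a codeword meets it in at least \<open>q - 1\<close> points. Hence a nonzero codeword has weight at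
  least \<open>(q - 1)\<^sup>2\<close>, with equality only if its zeros are two rows and two columns. In the basis of the
  four intersection points of these lines the form then agrees on \<open>X\<close> with a multiple of
  \<open>x\<^sub>1 x\<^sub>4\<close>, a pair of tangent planes.

  Conversely, a tangent plane section is a cone with a vertex, and this forces it to be a row together
  with a column; so both types of quadrics in the theorem lead to a zero set that contains two rows and
  two columns, which gives the weight \<open>(q - 1)\<^sup>2\<close>.
\<close>

section \<open>Polynomials and quadratic maps\<close>

text \<open>The rank counts indeterminates and says nothing directly about values. The bridge is
  translation invariance: a quadratic form f can lose an indeterminate exactly when f(x + v) = f(x)
  for all x and some nonzero v. Both uses of the rank go through it: rank 4 makes X nondegenerate,
  and rank 2 of a plane section provides its vertex. Since characteristic 2 is allowed, nothing is
  diagonalised, and a form is always carried together with its polar form. The two types of quadrics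
  are one family. Adding a multiple of the equation of X to a form does not change its codeword, and
  x1 x4 + t (x1 x4 - x2 x3) is a pair of tangent planes for t = 0 and t = -1, and otherwise a
  hyperbolic quadric through the same four lines. So the product x1 x4 can represent the codeword.
  Frames carry a scalar \<open>D\<close> so that the four intersection points form a frame of the
  same kind, to which all computations in coordinates apply again.\<close>

lemma eval_poly_superset:
  assumes "finite A" "Poly_Mapping.keys f \<subseteq> A"
  shows "eval_poly f x = (\<Sum>m\<in>A. Poly_Mapping.lookup f m * (\<Prod>i\<in>UNIV. (x $ i) ^ Poly_Mapping.lookup m i))"
  unfolding eval_poly_def using assms
  by (intro sum.mono_neutral_left) (auto simp: in_keys_iff)

lemma eval_poly_zero [simp]: "eval_poly 0 x = 0"
  by (simp add: eval_poly_def)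

lemma eval_poly_add: "eval_poly (f + g) x = eval_poly f x + eval_poly g x"
proof -
  let ?A = "Poly_Mapping.keys f \<union> Poly_Mapping.keys g"
  show ?thesis
    using keys_add[of f g]
    by (simp add: eval_poly_superset[of ?A] lookup_add algebra_simps sum.distrib)
qed

lemma eval_poly_sum: "eval_poly (sum p I) x = (\<Sum>i\<in>I. eval_poly (p i) x)"
  by (induction I rule: infinite_finite_induct) (simp_all add: eval_poly_add)

lemma eval_poly_single:
  "eval_poly (Poly_Mapping.single m c) x = c * (\<Prod>i\<in>UNIV. (x $ i) ^ Poly_Mapping.lookup m i)"
  by (subst eval_poly_superset[of "{m}"]) auto

lemma eval_poly_one [simp]: "eval_poly 1 x = 1"
  using eval_poly_single[of 0 1 x] by simp

lemma poly_mapping_eq_sum_single: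
  fixes f :: "'b \<Rightarrow>\<^sub>0 'c::comm_monoid_add"
  shows "f = (\<Sum>m\<in>Poly_Mapping.keys f. Poly_Mapping.single m (Poly_Mapping.lookup f m))"
  by (rule poly_mapping_eqI) (auto simp: lookup_sum lookup_single when_def in_keys_iff)

lemma eval_poly_mult: "eval_poly (f * g) x = eval_poly f x * eval_poly g x"
proof -
  have single: "eval_poly (Poly_Mapping.single m c * Poly_Mapping.single n d) x =
      eval_poly (Poly_Mapping.single m c) x * eval_poly (Poly_Mapping.single n d) x" for m n c d
    by (simp add: mult_single eval_poly_single lookup_add power_add prod.distrib algebra_simps)
  have "f * g = (\<Sum>m\<in>Poly_Mapping.keys f. \<Sum>n\<in>Poly_Mapping.keys g.
      Poly_Mapping.single m (Poly_Mapping.lookup f m) * Poly_Mapping.single n (Poly_Mapping.lookup g n))"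
    by (subst poly_mapping_eq_sum_single[of f], subst poly_mapping_eq_sum_single[of g])
      (simp only: sum_product)
  then have "eval_poly (f * g) x = (\<Sum>m\<in>Poly_Mapping.keys f. \<Sum>n\<in>Poly_Mapping.keys g.
      eval_poly (Poly_Mapping.single m (Poly_Mapping.lookup f m)) x *
      eval_poly (Poly_Mapping.single n (Poly_Mapping.lookup g n)) x)"
    by (simp add: eval_poly_sum single)
  also have "\<dots> = eval_poly f x * eval_poly g x"
    by (simp add: eval_poly_def[of f] eval_poly_def[of g] eval_poly_single sum_product)
  finally show ?thesis .
qed

lemma eval_poly_power: "eval_poly (f ^ n) x = eval_poly f x ^ n"
  by (induction n) (simp_all add: eval_poly_mult)

lemma eval_poly_prod: "eval_poly (prod p I) x = (\<Prod>i\<in>I. eval_poly (p i) x)"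
  by (induction I rule: infinite_finite_induct) (simp_all add: eval_poly_mult)

definition linear_form :: "'a::comm_ring_1 ^ 'n::finite \<Rightarrow> ('n, 'a) polyn" where
  "linear_form a = (\<Sum>j\<in>UNIV. Poly_Mapping.single (Poly_Mapping.single j 1) (a $ j))"

lemma prod_lookup_single:
  fixes x :: "'a::comm_ring_1 ^ 'n::finite"
  shows "(\<Prod>i\<in>UNIV. (x $ i) ^ Poly_Mapping.lookup (Poly_Mapping.single j n) i) = (x $ j) ^ n"
proof -
  have "(\<Prod>i\<in>UNIV. (x $ i) ^ Poly_Mapping.lookup (Poly_Mapping.single j n) i)
      = (\<Prod>i\<in>UNIV. if i = j then (x $ j) ^ n else 1)"
    by (rule prod.cong) (auto simp: lookup_single when_def)
  then show ?thesis by simp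
qed

lemma eval_linear_form: "eval_poly (linear_form a) x = (\<Sum>j\<in>UNIV. a $ j * x $ j)"
  by (simp add: linear_form_def eval_poly_sum eval_poly_single prod_lookup_single)

lemma linear_subst_eq: "linear_subst A = subst_poly (\<lambda>i. linear_form (A $ i))"
  by (simp add: linear_subst_def linear_form_def)

text \<open>Turns a coordinate change of polynomials into the action of \<open>A\<close> on vectors,
  so that the rank can be studied through values.\<close>

lemma eval_linear_subst: "eval_poly (linear_subst A f) y = eval_poly f (A *v y)"
proof -
  have "eval_poly (linear_form (A $ i)) y = (A *v y) $ i" for i
    by (simp add: eval_linear_form matrix_vector_mult_def)
  then show ?thesis
    by (simp add: linear_subst_eq subst_poly_def eval_poly_sum eval_poly_mult eval_poly_single
        eval_poly_prod eval_poly_power eval_poly_def[of f])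
qed

text \<open>An arbitrary degree is needed because substitution builds a quadratic form from
  constants and powers of linear forms.\<close>

definition homogeneous :: "nat \<Rightarrow> ('n::finite, 'a::comm_ring_1) polyn set" where
  "homogeneous d = {f. \<forall>m \<in> Poly_Mapping.keys f. (\<Sum>i\<in>UNIV. Poly_Mapping.lookup m i) = d}"

lemma quadratic_forms_eq: "quadratic_forms = homogeneous 2"
  by (simp add: quadratic_forms_def homogeneous_def)

lemma homogeneous_zero [simp]: "0 \<in> homogeneous d"
  by (simp add: homogeneous_def)

lemma homogeneous_single:
  "(\<Sum>i\<in>UNIV. Poly_Mapping.lookup m i) = d \<Longrightarrow> Poly_Mapping.single m c \<in> homogeneous d"
  by (simp add: homogeneous_def)

lemma homogeneous_sum:
  assumes "\<And>i. i \<in> I \<Longrightarrow> p i \<in> homogeneous d"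
  shows "sum p I \<in> homogeneous d"
  using assms
proof (induction I rule: infinite_finite_induct)
  case (insert i I)
  then have "p i \<in> homogeneous d" "sum p I \<in> homogeneous d" by auto
  then show ?case
    using insert keys_add[of "p i" "sum p I"] by (auto simp: homogeneous_def)
qed auto

lemma homogeneous_mult:
  assumes "f \<in> homogeneous d" "g \<in> homogeneous e"
  shows "f * g \<in> homogeneous (d + e)"
  unfolding homogeneous_def mem_Collect_eq
proof
  fix m assume "m \<in> Poly_Mapping.keys (f * g)"
  then obtain a b where "m = a + b" "a \<in> Poly_Mapping.keys f" "b \<in> Poly_Mapping.keys g"
    using keys_mult[of f g] by auto
  then show "(\<Sum>i\<in>UNIV. Poly_Mapping.lookup m i) = d + e"
    using assms by (simp add: homogeneous_def lookup_add sum.distrib)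
qed

lemma homogeneous_constant: "Poly_Mapping.single 0 c \<in> homogeneous 0"
  by (rule homogeneous_single) simp

lemma homogeneous_power: "f \<in> homogeneous d \<Longrightarrow> f ^ n \<in> homogeneous (n * d)"
proof (induction n)
  case 0
  then show ?case using homogeneous_constant[of 1] by simp
next
  case (Suc n)
  then show ?case using homogeneous_mult[of f d "f ^ n" "n * d"] by simp
qed

lemma homogeneous_prod:
  "finite I \<Longrightarrow> (\<And>i. i \<in> I \<Longrightarrow> p i \<in> homogeneous (e i)) \<Longrightarrow> prod p I \<in> homogeneous (sum e I)"
proof (induction I rule: finite_induct)
  case empty
  then show ?case using homogeneous_constant[of 1] by simp
next
  case (insert i I)
  then show ?case using homogeneous_mult[of "p i" "e i" "prod p I" "sum e I"] by simp
qed

lemma sum_lookup_single: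
  "(\<Sum>i\<in>UNIV. Poly_Mapping.lookup (Poly_Mapping.single (j::'n::finite) n) i) = (n::nat)"
proof -
  have "(\<Sum>i\<in>UNIV. Poly_Mapping.lookup (Poly_Mapping.single j n) i) = (\<Sum>i\<in>UNIV. if i = j then n else 0)"
    by (rule sum.cong) (auto simp: lookup_single when_def)
  then show ?thesis by simp
qed

lemma homogeneous_linear_form: "linear_form a \<in> homogeneous 1"
  unfolding linear_form_def by (intro homogeneous_sum homogeneous_single sum_lookup_single)

lemma linear_subst_quadratic:
  assumes "f \<in> quadratic_forms"
  shows "linear_subst A f \<in> quadratic_forms"
  unfolding quadratic_forms_eq linear_subst_eq subst_poly_def
proof (rule homogeneous_sum)
  fix m assume m: "m \<in> Poly_Mapping.keys f"
  have "(\<Prod>i\<in>UNIV. linear_form (A $ i) ^ Poly_Mapping.lookup m i)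
      \<in> homogeneous (\<Sum>i\<in>UNIV. Poly_Mapping.lookup m i)"
    by (intro homogeneous_prod homogeneous_power[OF homogeneous_linear_form, simplified] finite)
  then have "Poly_Mapping.single 0 (Poly_Mapping.lookup f m) *
      (\<Prod>i\<in>UNIV. linear_form (A $ i) ^ Poly_Mapping.lookup m i) \<in> homogeneous (0 + 2)"
    using m assms by (intro homogeneous_mult homogeneous_constant) (auto simp: quadratic_forms_def)
  then show "Poly_Mapping.single 0 (Poly_Mapping.lookup f m) *
      (\<Prod>i\<in>UNIV. linear_form (A $ i) ^ Poly_Mapping.lookup m i) \<in> homogeneous 2"
    by (simp only: add_0)
qed

definition quadratic_map :: "('a::comm_ring_1 ^ 'n::finite \<Rightarrow> 'a) \<Rightarrow> bool" where
  "quadratic_map q \<longleftrightarrow> (\<exists>M. \<forall>x. q x = (\<Sum>i\<in>UNIV. \<Sum>j\<in>UNIV. M i j * x $ i * x $ j))"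

text \<open>The associated bilinear form without the factor 1/2. In characteristic 2 it does not
  determine \<open>q\<close>.\<close>

definition polar :: "('a::comm_ring_1 ^ 'n::finite \<Rightarrow> 'a) \<Rightarrow> 'a ^ 'n \<Rightarrow> 'a ^ 'n \<Rightarrow> 'a" where
  "polar q x y = q (x + y) - q x - q y"

lemma degree_two_monomial:
  fixes m :: "'n::finite \<Rightarrow>\<^sub>0 nat"
  assumes "(\<Sum>i\<in>UNIV. Poly_Mapping.lookup m i) = 2" and i: "i \<in> Poly_Mapping.keys m"
  obtains j where "m = Poly_Mapping.single i 1 + Poly_Mapping.single j 1"
proof -
  define m' where "m' = m - Poly_Mapping.single i 1"
  have m: "m = Poly_Mapping.single i 1 + m'"
    using i by (intro poly_mapping_eqI)
      (auto simp: m'_def lookup_add lookup_minus lookup_single when_def in_keys_iff)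
  have s: "(\<Sum>k\<in>UNIV. Poly_Mapping.lookup m' k) = 1"
    using assms(1) by (simp add: m lookup_add sum.distrib sum_lookup_single)
  then obtain j where j: "Poly_Mapping.lookup m' j = 1"
      and z: "\<And>k. k \<noteq> j \<Longrightarrow> Poly_Mapping.lookup m' k = 0"
    using sum_eq_1_iff[of UNIV "Poly_Mapping.lookup m'"] by auto
  have "m' = Poly_Mapping.single j 1"
    by (rule poly_mapping_eqI) (auto simp: j z lookup_single when_def)
  with m that show ?thesis by blast
qed

lemma eval_poly_quadratic_map:
  fixes f :: "('n::finite, 'a::comm_ring_1) polyn"
  assumes "f \<in> quadratic_forms"
  shows "quadratic_map (eval_poly f)"
proof -
  have q_add: "quadratic_map (\<lambda>x. p x + r x)" if "quadratic_map p" "quadratic_map r"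
    for p r :: "'a ^ 'n \<Rightarrow> 'a"
  proof -
    from that obtain M N where "\<And>x. p x = (\<Sum>i\<in>UNIV. \<Sum>j\<in>UNIV. M i j * x $ i * x $ j)"
      "\<And>x. r x = (\<Sum>i\<in>UNIV. \<Sum>j\<in>UNIV. N i j * x $ i * x $ j)"
      by (auto simp: quadratic_map_def)
    then show ?thesis
      unfolding quadratic_map_def
      by (intro exI[of _ "\<lambda>i j. M i j + N i j"]) (simp add: algebra_simps sum.distrib)
  qed
  have q_zero: "quadratic_map (\<lambda>x::'a^'n. 0)"
    unfolding quadratic_map_def by (rule exI[of _ "\<lambda>_ _. 0"]) simp
  have q_sum: "quadratic_map (\<lambda>x. \<Sum>m\<in>I. p m x)" if "\<And>m. m \<in> I \<Longrightarrow> quadratic_map (p m)"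
    for I :: "('n \<Rightarrow>\<^sub>0 nat) set" and p :: "_ \<Rightarrow> 'a ^ 'n \<Rightarrow> 'a"
    using that by (induction I rule: infinite_finite_induct) (auto intro: q_zero q_add)
  have "quadratic_map (\<lambda>x. Poly_Mapping.lookup f m * (\<Prod>i\<in>UNIV. (x $ i) ^ Poly_Mapping.lookup m i))"
    if "m \<in> Poly_Mapping.keys f" for m
  proof -
    have s: "(\<Sum>i\<in>UNIV. Poly_Mapping.lookup m i) = 2"
      using assms that by (auto simp: quadratic_forms_def)
    then obtain i where "i \<in> Poly_Mapping.keys m"
      by (metis in_keys_iff sum.neutral zero_neq_numeral)
    with s obtain j where m: "m = Poly_Mapping.single i 1 + Poly_Mapping.single j 1"
      using degree_two_monomial by blast
    have "(\<Prod>k\<in>UNIV. (x $ k) ^ Poly_Mapping.lookup m k) = x $ i * x $ j" for x :: "'a ^ 'n"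
      using prod_lookup_single[of x i 1] prod_lookup_single[of x j 1]
      by (simp add: m lookup_add power_add prod.distrib)
    moreover have "(\<Sum>k\<in>UNIV. \<Sum>l\<in>UNIV. (if k = i \<and> l = j then c else 0) * x $ k * x $ l)
        = c * (x $ i * x $ j)" for x :: "'a ^ 'n" and c
    proof -
      have "(\<Sum>k\<in>UNIV. \<Sum>l\<in>UNIV. (if k = i \<and> l = j then c else 0) * x $ k * x $ l)
        = (\<Sum>k\<in>UNIV. if k = i then \<Sum>l\<in>UNIV. if l = j then c * x $ i * x $ j else 0 else 0)"
      proof (intro sum.cong refl)
        fix k
        show "(\<Sum>l\<in>UNIV. (if k = i \<and> l = j then c else 0) * x $ k * x $ l)
          = (if k = i then \<Sum>l\<in>UNIV. if l = j then c * x $ i * x $ j else 0 else 0)"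
          by (cases "k = i") (auto simp del: sum.delta sum.delta' intro!: sum.cong)
      qed
      then show ?thesis by (simp add: mult.assoc)
    qed
    ultimately show ?thesis
      unfolding quadratic_map_def
      by (intro exI[of _ "\<lambda>k l. if k = i \<and> l = j then Poly_Mapping.lookup f m else 0"]) simp
  qed
  then have "quadratic_map (\<lambda>x. \<Sum>m\<in>Poly_Mapping.keys f. Poly_Mapping.lookup f m * (\<Prod>i\<in>UNIV. (x $ i) ^ Poly_Mapping.lookup m i))"
    by (rule q_sum)
  then show ?thesis
    unfolding eval_poly_def[abs_def] .
qed

lemma quadratic_map_polar:
  assumes "quadratic_map q"
  shows "q (c *s x) = c\<^sup>2 * q x" "polar q (x + x') y = polar q x y + polar q x' y"
    "polar q (c *s x) y = c * polar q x y"
proof -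
  obtain M where q: "\<And>x. q x = (\<Sum>i\<in>UNIV. \<Sum>j\<in>UNIV. M i j * x $ i * x $ j)"
    using assms by (auto simp: quadratic_map_def)
  have p: "polar q x y = (\<Sum>i\<in>UNIV. \<Sum>j\<in>UNIV. M i j * (x $ i * y $ j + y $ i * x $ j))" for x y
    unfolding polar_def q by (simp add: algebra_simps sum.distrib flip: sum_subtractf)
  show "q (c *s x) = c\<^sup>2 * q x"
    unfolding q by (simp add: sum_distrib_left power2_eq_square algebra_simps)
  show "polar q (x + x') y = polar q x y + polar q x' y"
    unfolding p by (simp add: algebra_simps sum.distrib)
  show "polar q (c *s x) y = c * polar q x y"
    unfolding p by (simp add: sum_distrib_left algebra_simps)
qed

lemma polar_commute: "polar q x y = polar q y x"
  by (simp add: polar_def algebra_simps)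

lemma quadratic_map_polar_right:
  assumes "quadratic_map q"
  shows "polar q x (y + y') = polar q x y + polar q x y'" "polar q x (c *s y) = c * polar q x y"
  using quadratic_map_polar[OF assms] by (simp_all add: polar_commute[of q x])

lemma quadratic_map_add: "q (x + y) = q x + q y + polar q x y"
  by (simp add: polar_def)

lemma quadratic_map_zero: "quadratic_map q \<Longrightarrow> q 0 = 0"
  by (auto simp: quadratic_map_def)

lemma quadratic_map_polar_self: "quadratic_map q \<Longrightarrow> polar q x x = 2 * q x"
proof -
  assume "quadratic_map q"
  moreover have "x + x = 2 *s x"
    by (simp add: vec_eq_iff)
  ultimately show ?thesis
    using quadratic_map_polar(1)[of q 2 x] by (simp add: polar_def power2_eq_square)
qed

lemma quadratic_map_minus:
  assumes "quadratic_map q"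
  shows "q (- x) = q x" "polar q (- x) y = - polar q x y" "polar q x (- y) = - polar q x y"
    "polar q (x - x') y = polar q x y - polar q x' y" "polar q x (y - y') = polar q x y - polar q x y'"
    "q (x - y) = q x + q y - polar q x y"
proof -
  have m: "- z = (- 1) *s z" for z :: "'a ^ 'b" by (simp add: vec_eq_iff)
  show n: "q (- x) = q x" for x
    unfolding m[of x] quadratic_map_polar[OF assms] by simp
  show l: "polar q (- x) y = - polar q x y" for x y
    unfolding m[of x] quadratic_map_polar[OF assms] by simp
  show r: "polar q x (- y) = - polar q x y" for x y
    using l by (simp add: polar_commute[of q x])
  show "polar q (x - x') y = polar q x y - polar q x' y"
    using quadratic_map_polar(2)[OF assms, of x "- x'" y] l by simp
  show "polar q x (y - y') = polar q x y - polar q x y'"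
    using quadratic_map_polar_right(1)[OF assms, of x y "- y'"] r by simp
  show "q (x - y) = q x + q y - polar q x y"
    using quadratic_map_add[of q x "- y"] n r by simp
qed

section \<open>The rank of a quadratic form\<close>

lemma eval_poly_add_axis:
  assumes "i \<notin> indeterminates f"
  shows "eval_poly f (y + c *s axis i 1) = eval_poly f y"
  unfolding eval_poly_def
proof (rule sum.cong[OF refl])
  fix m assume "m \<in> Poly_Mapping.keys f"
  with assms have "Poly_Mapping.lookup m i = 0"
    by (auto simp: indeterminates_def in_keys_iff)
  then have "(\<Prod>k\<in>UNIV. ((y + c *s axis i 1) $ k) ^ Poly_Mapping.lookup m k) =
      (\<Prod>k\<in>UNIV. (y $ k) ^ Poly_Mapping.lookup m k)"
    by (intro prod.cong refl) (auto simp: axis_def)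
  then show "Poly_Mapping.lookup f m * (\<Prod>k\<in>UNIV. ((y + c *s axis i 1) $ k) ^ Poly_Mapping.lookup m k) =
      Poly_Mapping.lookup f m * (\<Prod>k\<in>UNIV. (y $ k) ^ Poly_Mapping.lookup m k)"
    by simp
qed

text \<open>Values at 0/1 vectors recover the coefficients of a quadratic form by inclusion and
  exclusion, over every field, however small.\<close>

lemma eval_poly_indicator:
  fixes f :: "('n::finite, 'a::comm_ring_1) polyn"
  shows "eval_poly f (\<chi> k. if k \<in> S then 1 else 0) =
    (\<Sum>m\<in>Poly_Mapping.keys f. if Poly_Mapping.keys m \<subseteq> S then Poly_Mapping.lookup f m else 0)"
  unfolding eval_poly_def
proof (rule sum.cong[OF refl])
  fix m :: "'n \<Rightarrow>\<^sub>0 nat"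
  show "Poly_Mapping.lookup f m *
      (\<Prod>k\<in>UNIV. ((\<chi> k. if k \<in> S then 1 else 0) $ k :: 'a) ^ Poly_Mapping.lookup m k) =
      (if Poly_Mapping.keys m \<subseteq> S then Poly_Mapping.lookup f m else 0)"
  proof (cases "Poly_Mapping.keys m \<subseteq> S")
    case True
    then have "(\<Prod>k\<in>UNIV. ((\<chi> k. if k \<in> S then 1 else 0) $ k :: 'a) ^ Poly_Mapping.lookup m k) = 1"
      by (intro prod.neutral) (auto, metis lookup_not_eq_zero_eq_in_keys power_0 subsetD)
    then show ?thesis using True by simp
  next
    case False
    then obtain k where "k \<notin> S" "Poly_Mapping.lookup m k \<noteq> 0"
      by (auto simp: in_keys_iff)
    then have "(\<Prod>k\<in>UNIV. ((\<chi> k. if k \<in> S then 1 else 0) $ k :: 'a) ^ Poly_Mapping.lookup m k) = 0"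
      by (intro prod_zero) (auto intro!: exI[of _ k] simp: power_0_left)
    then show ?thesis using False by simp
  qed
qed

text \<open>The coefficient of the square of x_i is f(e_i), and that of x_i x_j is f(e_i + e_j) -
  f(e_i) - f(e_j). Invariance under translation by e_i makes both vanish.\<close>

lemma not_in_indeterminates:
  fixes f :: "('n::finite, 'a::comm_ring_1) polyn"
  assumes f: "f \<in> quadratic_forms"
    and inv: "\<And>y. eval_poly f (y + axis i 1) = eval_poly f y"
  shows "i \<notin> indeterminates f"
proof
  assume "i \<in> indeterminates f"
  then obtain m where m: "m \<in> Poly_Mapping.keys f" "i \<in> Poly_Mapping.keys m"
    by (auto simp: indeterminates_def)
  have deg: "(\<Sum>k\<in>UNIV. Poly_Mapping.lookup n k) = 2" if "n \<in> Poly_Mapping.keys f" for n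
    using f that by (auto simp: quadratic_forms_def)
  obtain j where mj: "m = Poly_Mapping.single i 1 + Poly_Mapping.single j 1"
    using degree_two_monomial[OF deg m(2)] m(1) by blast
  define e where "e S = (\<chi> k. if k \<in> S then (1::'a) else 0)" for S :: "'n set"
  have nonempty: "Poly_Mapping.keys n \<noteq> {}" if "n \<in> Poly_Mapping.keys f" for n
    using deg[OF that] by auto
  have e_empty: "eval_poly f (e {}) = 0"
    unfolding e_def eval_poly_indicator by (rule sum.neutral) (auto dest: nonempty)
  have e_i: "eval_poly f (e {i}) = 0"
  proof -
    have "e {i} = e {} + axis i 1"
      by (auto simp: e_def vec_eq_iff axis_def)
    then show ?thesis using inv[of "e {}"] e_empty by simp
  qed
  have nz: "Poly_Mapping.lookup f m \<noteq> 0" using m by (simp add: in_keys_iff)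
  have keys_m: "Poly_Mapping.keys m = {i, j}"
    unfolding mj by (auto simp: in_keys_iff lookup_add lookup_single when_def split: if_splits)
  show False
  proof (cases "i = j")
    case True
    have "n = m" if n: "n \<in> Poly_Mapping.keys f" "Poly_Mapping.keys n \<subseteq> {i}" for n
    proof -
      obtain k where k: "n = Poly_Mapping.single i 1 + Poly_Mapping.single k 1"
        using degree_two_monomial[OF deg[OF n(1)], of i] nonempty n by blast
      with n(2) have "k = i"
        by (auto simp: subset_iff in_keys_iff lookup_add lookup_single when_def split: if_splits)
      then show ?thesis using k mj True by simp
    qed
    then have "Poly_Mapping.keys n \<subseteq> {i} \<longleftrightarrow> n = m" if "n \<in> Poly_Mapping.keys f" for n
      using keys_m True that by blast
    then have "eval_poly f (e {i}) = (\<Sum>n\<in>Poly_Mapping.keys f. if n = m then Poly_Mapping.lookup f n else 0)"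
      unfolding e_def eval_poly_indicator by (intro sum.cong refl) simp
    then show False using m e_i nz by simp
  next
    case False
    have "e {i, j} = e {j} + axis i 1"
      using False by (auto simp: e_def vec_eq_iff axis_def)
    then have "eval_poly f (e {i, j}) - eval_poly f (e {i}) - eval_poly f (e {j}) = 0"
      using inv[of "e {j}"] e_i by simp
    moreover have "eval_poly f (e {i, j}) - eval_poly f (e {i}) - eval_poly f (e {j}) =
      (\<Sum>n\<in>Poly_Mapping.keys f. if n = m then Poly_Mapping.lookup f n else 0)"
      unfolding e_def eval_poly_indicator sum_subtractf[symmetric]
    proof (rule sum.cong[OF refl])
      fix n assume n: "n \<in> Poly_Mapping.keys f"
      have *: "Poly_Mapping.keys n = {i, j} \<Longrightarrow> n = m"
      proof -
        assume kn: "Poly_Mapping.keys n = {i, j}"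
        then obtain k where k: "n = Poly_Mapping.single i 1 + Poly_Mapping.single k 1"
          using degree_two_monomial[OF deg[OF n], of i] by blast
        have "j \<in> Poly_Mapping.keys n" using kn by simp
        then have "k = j"
          using False by (auto simp: k in_keys_iff lookup_add lookup_single when_def split: if_splits)
        then show "n = m" using k mj by simp
      qed
      have "Poly_Mapping.keys n \<subseteq> {i, j} \<longleftrightarrow> Poly_Mapping.keys n = {i} \<or> Poly_Mapping.keys n = {j} \<or> n = m"
        using * nonempty[OF n] keys_m by blast
      moreover have "Poly_Mapping.keys n \<subseteq> {i} \<longleftrightarrow> Poly_Mapping.keys n = {i}"
        "Poly_Mapping.keys n \<subseteq> {j} \<longleftrightarrow> Poly_Mapping.keys n = {j}"
        using nonempty[OF n] by blast+
      ultimately show "(if Poly_Mapping.keys n \<subseteq> {i, j} then Poly_Mapping.lookup f n else 0) -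
          (if Poly_Mapping.keys n \<subseteq> {i} then Poly_Mapping.lookup f n else 0) -
          (if Poly_Mapping.keys n \<subseteq> {j} then Poly_Mapping.lookup f n else 0) =
          (if n = m then Poly_Mapping.lookup f n else 0)"
        using keys_m False by auto
    qed
    ultimately show False using m nz by simp
  qed
qed

lemma form_rank_witness:
  fixes f :: "('n::finite, 'a::field) polyn"
  obtains A :: "'a ^ 'n ^ 'n" where "invertible A"
    "form_rank f = card (indeterminates (linear_subst A f))"
proof -
  have "\<exists>r. \<exists>A :: 'a ^ 'n ^ 'n. invertible A \<and> r = card (indeterminates (linear_subst A f))"
    by (intro exI[of _ "card (indeterminates (linear_subst (mat 1) f))"] exI[of _ "mat 1"])
      (auto simp: invertible_def)
  from LeastI_ex[OF this] show ?thesis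
    using that unfolding form_rank_def by blast
qed

lemma invertible_mult_eq_0_iff:
  fixes A :: "'a::field ^ 'n ^ 'n"
  assumes "invertible A"
  shows "A *v x = 0 \<longleftrightarrow> x = 0"
proof
  assume "A *v x = 0"
  obtain B where "B ** A = mat 1" using assms by (auto simp: invertible_def)
  then have "x = B *v (A *v x)" by (simp add: matrix_vector_mul_assoc)
  with \<open>A *v x = 0\<close> show "x = 0" by simp
qed simp

lemma invertible_image:
  fixes A :: "'a::field ^ 'n ^ 'n"
  assumes "invertible A"
  obtains y where "x = A *v y"
proof -
  obtain B where "A ** B = mat 1" using assms by (auto simp: invertible_def)
  then have "x = A *v (B *v x)" by (simp add: matrix_vector_mul_assoc)
  then show ?thesis using that by blast
qed

lemma eval_poly_add_missing:
  fixes A :: "'a::field ^ 'n ^ 'n::finite"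
  assumes "invertible A" "i \<notin> indeterminates (linear_subst A f)"
  shows "eval_poly f (x + c *s (A *v axis i 1)) = eval_poly f x"
proof -
  obtain y where y: "x = A *v y" using invertible_image[OF assms(1)] .
  have "eval_poly f (A *v (y + c *s axis i 1)) = eval_poly f (A *v y)"
    using eval_poly_add_axis[OF assms(2), of y c] by (simp add: eval_linear_subst)
  then show ?thesis
    by (simp add: y matrix_vector_right_distrib vector_scalar_commute)
qed

text \<open>In coordinates attaining the rank some indeterminate is missing, and \<open>f\<close> is
  constant along the corresponding column of \<open>A\<close>.\<close>

lemma vertex_of_rank_less:
  fixes f :: "('n::finite, 'a::field) polyn"
  assumes "form_rank f < CARD('n)"
  obtains v where "v \<noteq> 0" "\<And>x c. eval_poly f (x + c *s v) = eval_poly f x"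
proof -
  obtain A :: "'a ^ 'n ^ 'n" where A: "invertible A"
    "form_rank f = card (indeterminates (linear_subst A f))"
    using form_rank_witness by blast
  then have "indeterminates (linear_subst A f) \<noteq> UNIV"
    using assms by auto
  then obtain i where i: "i \<notin> indeterminates (linear_subst A f)" by blast
  show ?thesis
  proof (rule that[of "A *v axis i 1"])
    show "A *v axis i 1 \<noteq> 0"
      by (simp add: invertible_mult_eq_0_iff[OF A(1)])
  qed (rule eval_poly_add_missing[OF A(1) i])
qed

lemma invertible_with_column:
  fixes v :: "'a::field ^ 'n"
  assumes "v \<noteq> 0"
  obtains A :: "'a ^ 'n ^ 'n" and k where "invertible A" "A *v axis k 1 = v"
proof -
  \<comment> \<open>The matrix below is the identity with column \<open>k\<close> replaced by
    \<open>v\<close>. Its determinant is \<open>v $ k\<close>, hence this choice of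
    \<open>k\<close>.\<close>
  obtain k where k: "v $ k \<noteq> 0" using assms by (auto simp: vec_eq_iff)
  define A :: "'a ^ 'n ^ 'n" where
    "A = (\<chi> r c. if c = k then v $ r else if r = c then 1 else 0)"
  have mult: "(A *v y) $ r = v $ r * y $ k + (if r = k then 0 else y $ r)" for y r
  proof -
    have "(A *v y) $ r = (\<Sum>c\<in>UNIV. (if c = k then v $ r * y $ k else 0) +
        (if c = r then (if r = k then 0 else y $ r) else 0))"
      unfolding matrix_vector_mult_def A_def vec_lambda_beta by (intro sum.cong) auto
    then show ?thesis by (simp add: sum.distrib)
  qed
  have "inj ((*v) A)"
  proof (rule injI)
    fix x y assume "A *v x = A *v y"
    then have *: "v $ r * x $ k + (if r = k then 0 else x $ r) =
        v $ r * y $ k + (if r = k then 0 else y $ r)" for r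
      by (metis mult)
    have xk: "x $ k = y $ k" using *[of k] k by simp
    have "x $ r = y $ r" for r using *[of r] xk by (cases "r = k") auto
    then show "x = y" by (simp add: vec_eq_iff)
  qed
  then have "invertible A"
    by (simp add: invertible_left_inverse matrix_left_invertible_injective)
  moreover have "A *v axis k 1 = v"
    by (simp add: vec_eq_iff mult axis_def)
  ultimately show ?thesis using that by blast
qed

text \<open>Converse of \<open>vertex_of_rank_less\<close>: in coordinates that have
  \<open>v\<close> as a basis vector, the matching indeterminate drops out.\<close>

lemma rank_less_of_vertex:
  fixes f :: "('n::finite, 'a::field) polyn"
  assumes f: "f \<in> quadratic_forms" and v: "v \<noteq> 0"
    and inv: "\<And>x. eval_poly f (x + v) = eval_poly f x"
  shows "form_rank f < CARD('n)"
proof -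
  obtain A :: "'a ^ 'n ^ 'n" and k where A: "invertible A" "A *v axis k 1 = v"
    using invertible_with_column[OF v] .
  have "k \<notin> indeterminates (linear_subst A f)"
    using inv by (intro not_in_indeterminates linear_subst_quadratic f)
      (simp add: eval_linear_subst matrix_vector_right_distrib A)
  then have "card (indeterminates (linear_subst A f)) < CARD('n)"
    by (intro psubset_card_mono) auto
  moreover have "form_rank f \<le> card (indeterminates (linear_subst A f))"
    unfolding form_rank_def by (rule Least_le) (use A in blast)
  ultimately show ?thesis by simp
qed

text \<open>The two conditions on \<open>v\<close> together give invariance under translation by
  \<open>v\<close>. In characteristic 2 the second does not imply the first.\<close>

lemma nondegenerate_of_full_rank:
  fixes f :: "('n::finite, 'a::field) polyn"
  assumes "f \<in> quadratic_forms" "form_rank f = CARD('n)"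
    and "eval_poly f v = 0" "\<And>x. polar (eval_poly f) x v = 0"
  shows "v = 0"
  using rank_less_of_vertex[OF assms(1), of v] assms(2-) by (auto simp: polar_def)

lemma eval_linear_form_axis [simp]: "eval_poly (linear_form (axis i 1)) x = x $ i"
proof -
  have "(\<Sum>j\<in>UNIV. axis i 1 $ j * x $ j) = (\<Sum>j\<in>UNIV. if j = i then x $ i else 0)"
    by (rule sum.cong) (auto simp: axis_def)
  then show ?thesis by (simp add: eval_linear_form)
qed

lemma linear_form_mult_quadratic: "linear_form a * linear_form b \<in> quadratic_forms"
  using homogeneous_mult[OF homogeneous_linear_form homogeneous_linear_form, of a b]
  by (simp add: quadratic_forms_eq numeral_2_eq_2)

text \<open>The third axis is a direction of invariance, so the rank is at most 2. With a smaller
  rank there would be two independent such directions, but each of them must lie on the third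
  axis.\<close>

lemma form_rank_product:
  "form_rank (linear_form (axis 1 1) * linear_form (axis 2 1) :: (3, 'a::field) polyn) = 2"
proof -
  let ?g = "linear_form (axis 1 1) * linear_form (axis 2 1) :: (3, 'a) polyn"
  have g: "eval_poly ?g y = y $ 1 * y $ 2" for y by (simp add: eval_poly_mult)
  have "form_rank ?g < CARD(3)"
    by (rule rank_less_of_vertex[OF linear_form_mult_quadratic, of "axis 3 1"])
      (auto simp: g axis_eq_0_iff, auto simp: axis_def)
  then have "form_rank ?g \<le> 2" by simp
  moreover have "2 \<le> form_rank ?g"
  proof (rule ccontr)
    assume "\<not> 2 \<le> form_rank ?g"
    obtain A :: "'a ^ 3 ^ 3" where A: "invertible A"
      "form_rank ?g = card (indeterminates (linear_subst A ?g))"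
      using form_rank_witness by blast
    let ?I = "indeterminates (linear_subst A ?g)"
    have "card (UNIV - ?I) = 3 - card ?I" by (simp add: card_Diff_subset)
    then have "2 \<le> card (UNIV - ?I)"
      using A(2) \<open>\<not> 2 \<le> form_rank ?g\<close> by linarith
    then obtain T where T: "T \<subseteq> UNIV - ?I" "card T = 2"
      by (rule obtain_subset_with_card_n)
    then obtain i j where ij: "i \<noteq> j" "i \<notin> ?I" "j \<notin> ?I"
      unfolding card_2_iff by blast
    have first_two: "(A *v axis k 1) $ 1 = 0 \<and> (A *v axis k 1) $ 2 = 0" if "k \<notin> ?I" for k
    proof -
      define z where "z = A *v axis k 1"
      have inv: "eval_poly ?g (x + z) = eval_poly ?g x" for x
        using eval_poly_add_missing[OF A(1) that, of x 1] by (simp add: z_def)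
      have "z $ 1 * z $ 2 = 0" "(1 + z $ 1) * z $ 2 = 0" "z $ 1 * (1 + z $ 2) = 0"
        using inv[of 0] inv[of "axis 1 1"] inv[of "axis 2 1"] unfolding g by (simp_all add: axis_def)
      then show ?thesis
        unfolding z_def[symmetric] by (auto simp: algebra_simps)
    qed
    \<comment> \<open>Columns \<open>i\<close> and \<open>j\<close> of \<open>A\<close> are both
      multiples of the third axis vector, so the combination with these coefficients
      cancels.\<close>
    define a b where "a = (A *v axis i 1) $ 3" and "b = (A *v axis j 1) $ 3"
    have "A *v (b *s axis i 1 - a *s axis j 1) = 0"
      using first_two[OF ij(2)] first_two[OF ij(3)]
      by (simp add: matrix_vector_mult_diff_distrib vector_scalar_commute vec_eq_iff forall_3 a_def b_def)
    then have "b *s axis i 1 = a *s (axis j 1 :: 'a ^ 3)"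
      by (simp add: invertible_mult_eq_0_iff[OF A(1)])
    then have "b * axis i 1 $ i = a * (axis j 1 :: 'a ^ 3) $ i"
      by (metis vector_smult_component)
    then have "b = 0" using ij by (simp add: axis_def)
    then have "A *v axis j 1 = 0"
      using first_two[OF ij(3)] by (simp add: vec_eq_iff forall_3 b_def)
    then show False by (simp add: invertible_mult_eq_0_iff[OF A(1)] axis_eq_0_iff)
  qed
  ultimately show ?thesis by simp
qed

section \<open>Hyperbolic frames\<close>

definition proj_point :: "'a::field ^ 4 \<Rightarrow> 'a ^ 4" where
  "proj_point v = (SOME p. p \<in> points \<and> (\<exists>c. c \<noteq> 0 \<and> p = c *s v))"

lemma points_nonzero: "x \<in> points \<Longrightarrow> x \<noteq> 0"
  by (auto simp: points_def)

lemma points_scale_unique: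
  assumes "x \<in> points" "y \<in> points" "x = c *s y"
  shows "x = y"
proof -
  obtain i where i: "x $ i = 1" "\<forall>j<i. x $ j = 0" using assms(1) by (auto simp: points_def)
  obtain k where k: "y $ k = 1" "\<forall>j<k. y $ j = 0" using assms(2) by (auto simp: points_def)
  have "c \<noteq> 0" using assms by (auto dest: points_nonzero)
  then have "i = k"
    using i k assms(3) by (metis linorder_cases mult_eq_0_iff vector_smult_component zero_neq_one)
  then have "c = 1" using i k assms(3) by simp
  then show ?thesis using assms(3) by simp
qed

lemma proj_point:
  assumes "v \<noteq> 0"
  shows "proj_point v \<in> points" "\<exists>c. c \<noteq> 0 \<and> proj_point v = c *s v"
proof -
  let ?S = "{i. v $ i \<noteq> 0}"
  have "?S \<noteq> {}" using assms by (auto simp: vec_eq_iff)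
  then have "Min ?S \<in> ?S" by (intro Min_in) auto
  moreover have "v $ j = 0" if "j < Min ?S" for j
    using that Min_le[of ?S j] by (auto simp flip: not_le)
  ultimately obtain k where k: "v $ k \<noteq> 0" "\<And>j. j < k \<Longrightarrow> v $ j = 0" by blast
  then have "inverse (v $ k) *s v \<in> points"
    by (auto simp: points_def intro!: exI[of _ k])
  then have "\<exists>p. p \<in> points \<and> (\<exists>c. c \<noteq> 0 \<and> p = c *s v)"
    using nonzero_imp_inverse_nonzero[OF k(1)] by blast
  from someI_ex[OF this] show "proj_point v \<in> points" "\<exists>c. c \<noteq> 0 \<and> proj_point v = c *s v"
    by (auto simp: proj_point_def)
qed

lemma proj_point_eqI:
  assumes "x \<in> points" "x = c *s v"
  shows "proj_point v = x"
proof -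
  have "v \<noteq> 0" "c \<noteq> 0" using points_nonzero[OF assms(1)] assms(2) by auto
  then obtain d where d: "proj_point v = d *s v" "d \<noteq> 0" using proj_point(2) by blast
  have "proj_point v = (d / c) *s x"
    using \<open>c \<noteq> 0\<close> by (simp add: assms(2) d)
  then show ?thesis using points_scale_unique[OF proj_point(1)[OF \<open>v \<noteq> 0\<close>] assms(1)] by blast
qed

lemma proj_point_zero_iff:
  assumes "quadratic_map q" "v \<noteq> 0"
  shows "q (proj_point v) = 0 \<longleftrightarrow> q v = 0"
  using proj_point(2)[OF assms(2)] quadratic_map_polar(1)[OF assms(1)] by auto

lemma proj_point_mem_subspace_iff:
  assumes "vec.subspace S" "v \<noteq> 0"
  shows "proj_point v \<in> S \<longleftrightarrow> v \<in> S"
proof -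
  obtain c where c: "c \<noteq> 0" "proj_point v = c *s v" using proj_point(2)[OF assms(2)] by blast
  then have "v = inverse c *s proj_point v" by simp
  with c show ?thesis using vec.subspace_scale[OF assms(1)] by metis
qed

text \<open>Scaling \<open>w\<close> by \<open>c\<close> makes its pairing with \<open>u\<close>
  equal to 1. As \<open>u\<close> is isotropic, adding d u then changes the value of
  \<open>Q\<close> by exactly d, so d is minus the value of \<open>Q\<close> at the scaled
  \<open>w\<close>.\<close>

lemma hyperbolic_partner:
  assumes quad: "quadratic_map Q" and "Q u = 0" "polar Q w u \<noteq> (0::'a::field)"
  obtains c d where "Q (c *s w + d *s u) = 0" "polar Q u (c *s w + d *s u) = 1"
proof -
  note qs = quadratic_map_polar[OF quad] quadratic_map_polar_right[OF quad] quadratic_map_add[of Q]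
    quadratic_map_polar_self[OF quad] quadratic_map_minus[OF quad]
  define c where "c = inverse (polar Q w u)"
  have c: "c * polar Q w u = 1" using assms by (simp add: c_def)
  have cu: "polar Q (c *s w) ((c\<^sup>2 * Q w) *s u) = c\<^sup>2 * Q w * (c * polar Q w u)"
    by (simp add: qs)
  have "Q (c *s w + (- (c\<^sup>2 * Q w)) *s u) = c\<^sup>2 * Q w - c\<^sup>2 * Q w * (c * polar Q w u)"
    by (simp add: qs assms power2_eq_square algebra_simps)
  moreover have "polar Q u (c *s w + (- (c\<^sup>2 * Q w)) *s u) = c * polar Q w u"
    by (simp add: qs assms polar_commute[of Q u w])
  ultimately show ?thesis using that[of c "- (c\<^sup>2 * Q w)"] c by simp
qed

text \<open>In coordinates with respect to e1, ..., e4 these conditions say that \<open>Q\<close> is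
  D (x1 x4 - x2 x3). The scalar is kept because frames made of other points of the quadric have
  their own \<open>D\<close>; see \<open>segre_frame\<close>.\<close>

locale hyperbolic_frame =
  fixes Q :: "'a::{field,finite} ^ 4 \<Rightarrow> 'a" and e1 e2 e3 e4 :: "'a ^ 4" and D :: 'a
  assumes quad: "quadratic_map Q" and D: "D \<noteq> 0"
    and isotropic: "Q e1 = 0" "Q e2 = 0" "Q e3 = 0" "Q e4 = 0"
    and gram: "polar Q e1 e2 = 0" "polar Q e1 e3 = 0" "polar Q e2 e4 = 0" "polar Q e3 e4 = 0"
      "polar Q e1 e4 = D" "polar Q e2 e3 = - D"

text \<open>The elliptic case: the orthogonal complement \<open>K\<close> of the hyperbolic pair
  \<open>v\<close>, \<open>w\<close> is anisotropic. An isotropic point other than that of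
  \<open>v\<close> has a nonzero \<open>w\<close>-coordinate. Once this is scaled to 1, the
  component k in \<open>K\<close> forces the \<open>v\<close>-coordinate to be -Q(k), so there are
  at most |K| + 1 points.\<close>

lemma card_isotropic_le:
  fixes Q :: "'a::{field,finite} ^ 4 \<Rightarrow> 'a"
  assumes quad: "quadratic_map Q" and "Q v = 0" "Q w = 0" "polar Q v w = 1"
    and aniso: "\<And>h. polar Q h v = 0 \<Longrightarrow> polar Q h w = 0 \<Longrightarrow> Q h = 0 \<Longrightarrow> h = 0"
  shows "card {x \<in> points. Q x = 0} \<le> CARD('a)\<^sup>2 + 1"
proof -
  note qs = quadratic_map_polar[OF quad] quadratic_map_polar_right[OF quad] quadratic_map_add[of Q]
    quadratic_map_polar_self[OF quad] quadratic_map_minus[OF quad]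
  have wv: "polar Q w v = 1" using assms by (simp add: polar_commute[of Q w])
  define K where "K = {h. polar Q h v = 0 \<and> polar Q h w = 0}"
  \<comment> \<open>\<open>K\<close> is independent of the span of \<open>v\<close> and
    \<open>w\<close>. Counting vectors gives |K| q^2 <= q^4 without computing a dimension.\<close>
  have "inj_on (\<lambda>(h, a, b). h + (a *s v + b *s w)) (K \<times> UNIV)"
  proof (rule inj_onI, clarsimp)
    fix h a b h' a' b'
    assume K: "h \<in> K" "h' \<in> K" and eq: "h + (a *s v + b *s w) = h' + (a' *s v + b' *s w)"
    have "polar Q (h + (a *s v + b *s w)) v = b" "polar Q (h' + (a' *s v + b' *s w)) v = b'"
      "polar Q (h + (a *s v + b *s w)) w = a" "polar Q (h' + (a' *s v + b' *s w)) w = a'"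
      using K assms wv by (simp_all add: K_def qs)
    then have "a = a'" "b = b'" using eq by metis+
    with eq show "h = h' \<and> a = a' \<and> b = b'" by simp
  qed
  then have "card (K \<times> (UNIV :: ('a \<times> 'a) set)) \<le> CARD('a ^ 4)"
    by (rule card_inj_on_le) auto
  then have "card K * (CARD('a) * CARD('a)) \<le> (CARD('a) * CARD('a)) * (CARD('a) * CARD('a))"
    by (simp add: card_cartesian_product power4_eq_xxxx mult.assoc)
  then have cK: "card K \<le> CARD('a)\<^sup>2" by (simp add: power2_eq_square)
  have "{x \<in> points. Q x = 0} \<subseteq> insert (proj_point v) ((\<lambda>k. proj_point (k + (- Q k) *s v + w)) ` K)"
  proof clarify
    fix x assume x: "x \<in> points" "Q x = 0"
      and not: "x \<notin> (\<lambda>k. proj_point (k + (- Q k) *s v + w)) ` K"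
    \<comment> \<open>Since \<open>v\<close> and \<open>w\<close> are isotropic and pair to 1, the
      coefficient of \<open>v\<close> is the pairing with \<open>w\<close>, and conversely.\<close>
    define a b where "a = polar Q x w" and "b = polar Q x v"
    define h where "h = x + (- a) *s v + (- b) *s w"
    have hK: "h \<in> K"
      using assms wv by (simp add: K_def h_def qs a_def b_def)
    have xh: "x = h + a *s v + b *s w" by (simp add: h_def)
    have Qh: "Q h + a * b = 0"
      using x(2) hK unfolding K_def by (simp add: xh qs assms algebra_simps)
    show "x = proj_point v"
    proof (cases "b = 0")
      case True
      then have "h = 0" using aniso hK Qh by (simp add: K_def)
      then show ?thesis using proj_point_eqI[OF x(1), of a v] xh True by simp
    next
      case False
      define k where "k = inverse b *s h"
      have "k \<in> K" using hK by (simp add: k_def K_def qs)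
      have "a = - b * Q k"
        using Qh False by (simp add: k_def qs power2_eq_square field_simps add_eq_0_iff)
      then have "x = b *s (k + (- Q k) *s v + w)"
        using False by (simp add: xh k_def vector_add_ldistrib vector_smult_assoc)
      then have "x = proj_point (k + (- Q k) *s v + w)"
        using proj_point_eqI[OF x(1)] by metis
      then show ?thesis using not \<open>k \<in> K\<close> by blast
    qed
  qed
  then have "card {x \<in> points. Q x = 0} \<le> card (insert (proj_point v) ((\<lambda>k. proj_point (k + (- Q k) *s v + w)) ` K))"
    by (intro card_mono) auto
  also have "\<dots> \<le> Suc (card ((\<lambda>k. proj_point (k + (- Q k) *s v + w)) ` K))"
    by (rule card_insert_le_m1) auto
  also have "\<dots> \<le> Suc (card K)" by (simp add: card_image_le)
  finally show ?thesis using cK by simp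
qed

text \<open>After one hyperbolic pair \<open>v\<close>, \<open>w\<close> is split off, the point
  count exceeds the bound for an anisotropic complement. So the complement contains an isotropic
  vector, which has a hyperbolic partner there.\<close>

lemma hyperbolic_frame_exists:
  fixes Q :: "'a::{field,finite} ^ 4 \<Rightarrow> 'a"
  assumes quad: "quadratic_map Q"
    and nondeg: "\<And>v. Q v = 0 \<Longrightarrow> (\<And>x. polar Q x v = 0) \<Longrightarrow> v = 0"
    and card: "card {x \<in> points. Q x = 0} = (CARD('a) + 1)\<^sup>2"
  obtains e1 e2 e3 e4 where "hyperbolic_frame Q e1 e2 e3 e4 1"
proof -
  note qs = quadratic_map_polar[OF quad] quadratic_map_polar_right[OF quad] quadratic_map_add[of Q]
    quadratic_map_polar_self[OF quad] quadratic_map_minus[OF quad]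
  have "card {x \<in> points. Q x = 0} \<noteq> 0" using card by simp
  then obtain v where v: "v \<in> points" "Q v = 0"
    by (metis (mono_tags, lifting) Collect_empty_eq card.empty)
  then obtain w0 where "polar Q w0 v \<noteq> 0" using nondeg points_nonzero by blast
  then obtain w where w: "Q w = 0" "polar Q v w = 1"
    using hyperbolic_partner[OF quad v(2)] by metis
  have wv: "polar Q w v = 1" using w by (simp add: polar_commute[of Q w])
  have "CARD('a)\<^sup>2 + 1 < (CARD('a) + 1)\<^sup>2" by (simp add: power2_eq_square)
  then obtain u where u: "polar Q u v = 0" "polar Q u w = 0" "Q u = 0" "u \<noteq> 0"
    using card_isotropic_le[OF quad v(2) w] card by (metis not_le)
  then obtain x where x: "polar Q x u \<noteq> 0" using nondeg by blast
  \<comment> \<open>The projection of \<open>x\<close> to the complement of \<open>v\<close> and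
    \<open>w\<close>. Its pairing with \<open>u\<close> is that of \<open>x\<close>, because
    \<open>u\<close> is orthogonal to both.\<close>
  define y where "y = x + (- polar Q x w) *s v + (- polar Q x v) *s w"
  have vu: "polar Q v u = 0" "polar Q w u = 0" using u by (simp_all add: polar_commute[of Q _ u])
  have y: "polar Q y u = polar Q x u" "polar Q y v = 0" "polar Q y w = 0"
    using u v w wv vu by (simp_all add: y_def qs)
  then obtain c d where z: "Q (c *s y + d *s u) = 0" "polar Q u (c *s y + d *s u) = 1"
    using hyperbolic_partner[OF quad u(3), of y] x by metis
  define z where "z = c *s y + d *s u"
  have "polar Q z v = 0" "polar Q z w = 0" using y u by (simp_all add: z_def qs)
  \<comment> \<open>The sign of \<open>z\<close> is reversed because a frame requires the second and
    third vectors to pair to \<open>- D\<close>.\<close>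
  then have "hyperbolic_frame Q v u ((- 1) *s z) w 1"
    using z u v w vu quad unfolding z_def[symmetric]
    by unfold_locales (simp_all only: qs, simp_all add: polar_commute[of Q v z])
  then show ?thesis using that by blast
qed

section \<open>The Segre parametrisation\<close>

text \<open>The points of the projective line, as coordinate pairs whose first nonzero entry is 1.\<close>

definition line_points :: "('a::field \<times> 'a) set" where
  "line_points = insert (0, 1) (range (Pair 1))"

text \<open>The 2 by 2 determinant. On normalised pairs it vanishes only for equal
  arguments.\<close>

definition cross :: "'a::field \<times> 'a \<Rightarrow> 'a \<times> 'a \<Rightarrow> 'a" where
  "cross s t = fst s * snd t - snd s * fst t"

definition pencil :: "'a::field ^ 'n \<Rightarrow> 'a ^ 'n \<Rightarrow> 'a \<times> 'a \<Rightarrow> 'a ^ 'n" where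
  "pencil u v s = fst s *s u + snd s *s v"

lemma card_line_points: "card (line_points :: ('a::{field,finite} \<times> 'a) set) = CARD('a) + 1"
proof -
  have "card (range (Pair (1::'a)) :: ('a \<times> 'a) set) = CARD('a)"
    by (rule card_image) (auto simp: inj_on_def)
  then show ?thesis unfolding line_points_def by (subst card_insert_disjoint) auto
qed

lemma cross_eq_0:
  assumes "s \<in> line_points" "t \<in> line_points" "cross s t = 0"
  shows "s = t"
  using assms by (auto simp: line_points_def cross_def)

lemma cross_self [simp]: "cross s s = 0"
  by (simp add: cross_def)

lemma ex_cross_nonzero:
  assumes "s \<in> line_points"
  obtains t where "t \<in> line_points" "cross s t \<noteq> (0 :: 'a::field)"
proof (cases "s = (0, 1)")
  case True
  then show ?thesis by (intro that[of "(1, 0)"]) (auto simp: line_points_def cross_def)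
next
  case False
  then show ?thesis using assms by (intro that[of "(0, 1)"]) (auto simp: line_points_def cross_def)
qed

lemma line_points_representative:
  assumes "s \<noteq> (0, 0)"
  obtains c s' where "c \<noteq> 0" "s' \<in> line_points" "s = (c * fst s', c * snd s')"
proof (cases "fst s = 0")
  case True
  then show ?thesis using assms by (intro that[of "snd s" "(0, 1)"]) (auto simp: line_points_def prod_eq_iff)
next
  case False
  then show ?thesis by (intro that[of "fst s" "(1, snd s / fst s)"]) (auto simp: line_points_def prod_eq_iff)
qed

lemma pencil_scale: "pencil u v (c * fst s, c * snd s) = c *s pencil u v s"
  by (simp add: pencil_def vector_add_ldistrib)

text \<open>Cramer's rule for the coordinates of \<open>s\<close> in the basis \<open>s1\<close>,
  \<open>s2\<close>.\<close>

lemma pencil_basis_change: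
  assumes "cross s1 s2 \<noteq> 0"
  shows "pencil u v s = pencil (pencil u v s1) (pencil u v s2)
    (cross s s2 / cross s1 s2, cross s1 s / cross s1 s2)"
proof -
  have "fst s = (cross s s2 * fst s1 + cross s1 s * fst s2) / cross s1 s2"
    "snd s = (cross s s2 * snd s1 + cross s1 s * snd s2) / cross s1 s2"
    using assms by (simp_all add: nonzero_eq_divide_eq) (simp_all add: cross_def algebra_simps)
  then show ?thesis
    by (simp add: pencil_def vec_eq_iff algebra_simps add_divide_distrib)
qed

lemma quadratic_map_pencil:
  assumes quad: "quadratic_map q"
  shows "q (pencil u v s) = (fst s)\<^sup>2 * q u + (snd s)\<^sup>2 * q v + fst s * snd s * polar q u v"
  by (simp add: pencil_def quadratic_map_polar[OF quad] quadratic_map_polar_right[OF quad]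
      quadratic_map_add[of q])

text \<open>With two zeros as base points, only the mixed term of the restricted form survives. The
  third zero has both coordinates nonzero in this basis, so it kills that term too.\<close>

lemma pencil_vanishes:
  assumes quad: "quadratic_map q" and Z: "Z \<subseteq> line_points" "3 \<le> card Z"
    and z: "\<And>s. s \<in> Z \<Longrightarrow> q (pencil u v s) = 0"
  shows "q (pencil u v s) = 0"
proof -
  obtain T where T: "T \<subseteq> Z" "card T = 3"
    using Z(2) by (rule obtain_subset_with_card_n)
  then obtain s1 s2 s3 where s: "s1 \<in> Z" "s2 \<in> Z" "s3 \<in> Z" "s1 \<noteq> s2" "s1 \<noteq> s3" "s3 \<noteq> s2"
    unfolding card_3_iff by blast
  then have nz: "cross s1 s2 \<noteq> 0" "cross s1 s3 \<noteq> 0" "cross s3 s2 \<noteq> 0"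
    using cross_eq_0 Z(1) by blast+
  define u' v' where "u' = pencil u v s1" and "v' = pencil u v s2"
  have q: "q u' = 0" "q v' = 0" "q (pencil u v s3) = 0"
    using z s by (simp_all add: u'_def v'_def)
  have "polar q u' v' = 0"
    using q(3) nz unfolding pencil_basis_change[OF nz(1), of u v s3] u'_def[symmetric] v'_def[symmetric]
    by (simp add: quadratic_map_pencil[OF quad] q)
  then show ?thesis
    unfolding pencil_basis_change[OF nz(1), of u v s] u'_def[symmetric] v'_def[symmetric]
    by (simp add: quadratic_map_pencil[OF quad] q)
qed

lemma card_pencil_nonzeros:
  fixes q :: "'a::{field,finite} ^ 'n \<Rightarrow> 'a"
  assumes quad: "quadratic_map q" and nz: "q (pencil u v s0) \<noteq> 0"
  shows "CARD('a) - 1 \<le> card {s \<in> line_points. q (pencil u v s) \<noteq> 0}"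
proof -
  let ?Z = "{s \<in> line_points. q (pencil u v s) = 0}"
  have "\<not> 3 \<le> card ?Z"
  proof
    assume "3 \<le> card ?Z"
    then have "q (pencil u v s0) = 0" by (rule pencil_vanishes[OF quad, of ?Z, rotated]) auto
    with nz show False by simp
  qed
  moreover have "card (line_points - ?Z) = CARD('a) + 1 - card ?Z"
    unfolding card_line_points[symmetric] by (intro card_Diff_subset) auto
  moreover have "line_points - ?Z = {s \<in> line_points. q (pencil u v s) \<noteq> 0}" by blast
  ultimately show ?thesis by simp
qed

text \<open>One nonempty line of the grid in each direction already shows that at least
  \<open>d\<close> lines of the other direction are nonempty, and each contributes at least
  \<open>d\<close> elements. In the case of equality there are exactly \<open>d\<close> in each
  direction, so \<open>B\<close> fills the product of its projections.\<close>

lemma grid_bound: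
  fixes B :: "('b \<times> 'c) set"
  assumes "finite B" "B \<noteq> {}"
    and cols: "\<And>s t. (s, t) \<in> B \<Longrightarrow> d \<le> card {s'. (s', t) \<in> B}"
    and rows: "\<And>s t. (s, t) \<in> B \<Longrightarrow> d \<le> card {t'. (s, t') \<in> B}"
  shows "d\<^sup>2 \<le> card B"
    and "card B = d\<^sup>2 \<Longrightarrow> 0 < d \<Longrightarrow> B = fst ` B \<times> snd ` B \<and> card (fst ` B) = d \<and> card (snd ` B) = d"
proof -
  have fin: "finite (fst ` B)" "finite (snd ` B)" using assms by auto
  have fin': "finite {s. (s, t) \<in> B}" "finite {t. (s, t) \<in> B}" for s t
    by (rule finite_subset[OF _ fin(1)], force) (rule finite_subset[OF _ fin(2)], force)
  obtain s0 t0 where st: "(s0, t0) \<in> B" using assms(2) by auto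
  have "{s'. (s', t0) \<in> B} \<subseteq> fst ` B" "{t'. (s0, t') \<in> B} \<subseteq> snd ` B"
    by (force simp: image_iff)+
  then have d: "d \<le> card (fst ` B)" "d \<le> card (snd ` B)"
    using cols[OF st] rows[OF st] card_mono[OF fin(1)] card_mono[OF fin(2)] by (meson le_trans)+
  have "B = prod.swap ` (SIGMA t:snd ` B. {s. (s, t) \<in> B})"
    by (force simp: image_iff)
  then have "card B = card (prod.swap ` (SIGMA t:snd ` B. {s. (s, t) \<in> B}))"
    by (rule arg_cong)
  also have "\<dots> = card (SIGMA t:snd ` B. {s. (s, t) \<in> B})"
    by (rule card_image) simp
  also have "\<dots> = (\<Sum>t\<in>snd ` B. card {s. (s, t) \<in> B})"
    by (intro card_SigmaI ballI fin fin')
  also have "\<dots> \<ge> (\<Sum>t\<in>snd ` B. d)"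
    by (rule sum_mono) (auto intro: cols)
  finally have c2: "card (snd ` B) * d \<le> card B" by simp
  have "B = (SIGMA s:fst ` B. {t. (s, t) \<in> B})"
    by (force simp: image_iff)
  then have "card B = card (SIGMA s:fst ` B. {t. (s, t) \<in> B})" by (rule arg_cong)
  also have "\<dots> = (\<Sum>s\<in>fst ` B. card {t. (s, t) \<in> B})"
    by (intro card_SigmaI ballI fin fin')
  also have "\<dots> \<ge> (\<Sum>s\<in>fst ` B. d)"
    by (rule sum_mono) (auto intro: rows)
  finally have c1: "card (fst ` B) * d \<le> card B" by simp
  show "d\<^sup>2 \<le> card B"
    unfolding power2_eq_square by (rule le_trans[OF mult_le_mono1[OF d(1)] c1])
  assume eq: "card B = d\<^sup>2" "0 < d"
  then have c: "card (fst ` B) = d" "card (snd ` B) = d"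
    using c1 c2 d by (simp_all add: power2_eq_square)
  have "B = fst ` B \<times> snd ` B"
  proof (rule card_subset_eq)
    show "B \<subseteq> fst ` B \<times> snd ` B" by force
    show "card B = card (fst ` B \<times> snd ` B)"
      by (simp add: card_cartesian_product c eq power2_eq_square)
  qed (use fin in simp)
  with c show "B = fst ` B \<times> snd ` B \<and> card (fst ` B) = d \<and> card (snd ` B) = d" by blast
qed

section \<open>The Segre map of a frame and the grid of its quadric\<close>

context hyperbolic_frame
begin

lemmas Q_simps = quadratic_map_polar[OF quad] quadratic_map_polar_right[OF quad] quadratic_map_add[of Q]
  quadratic_map_polar_self[OF quad] isotropic gram

lemma gram':
  "polar Q e2 e1 = 0" "polar Q e3 e1 = 0" "polar Q e4 e2 = 0" "polar Q e4 e3 = 0"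
  "polar Q e4 e1 = D" "polar Q e3 e2 = - D"
  using gram by (simp_all add: polar_commute[of Q e2 e1] polar_commute[of Q e3 e1]
      polar_commute[of Q e4 e2] polar_commute[of Q e4 e3] polar_commute[of Q e4 e1] polar_commute[of Q e3 e2])

definition comb :: "'a \<Rightarrow> 'a \<Rightarrow> 'a \<Rightarrow> 'a \<Rightarrow> 'a ^ 4" where
  "comb x1 x2 x3 x4 = x1 *s e1 + x2 *s e2 + x3 *s e3 + x4 *s e4"

lemma Q_comb: "Q (comb x1 x2 x3 x4) = D * (x1 * x4 - x2 * x3)"
  by (simp add: comb_def Q_simps gram' algebra_simps)

lemma polar_comb:
  "polar Q (comb x1 x2 x3 x4) e1 = D * x4" "polar Q (comb x1 x2 x3 x4) e2 = - D * x3"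
  "polar Q (comb x1 x2 x3 x4) e3 = - D * x2" "polar Q (comb x1 x2 x3 x4) e4 = D * x1"
  by (simp_all add: comb_def Q_simps gram')

lemma comb_eq_iff:
  "comb x1 x2 x3 x4 = comb y1 y2 y3 y4 \<longleftrightarrow> x1 = y1 \<and> x2 = y2 \<and> x3 = y3 \<and> x4 = y4"
proof
  assume eq: "comb x1 x2 x3 x4 = comb y1 y2 y3 y4"
  have "D * x1 = D * y1" "- D * x2 = - D * y2" "- D * x3 = - D * y3" "D * x4 = D * y4"
    using eq by (metis polar_comb)+
  then show "x1 = y1 \<and> x2 = y2 \<and> x3 = y3 \<and> x4 = y4" using D by simp
qed simp

lemma comb_zero: "comb 0 0 0 0 = 0"
  by (simp add: comb_def)

text \<open>The Gram matrix makes the coordinate map injective, and both sides have q^4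
  elements.\<close>

lemma comb_surj:
  obtains x1 x2 x3 x4 where "v = comb x1 x2 x3 x4"
proof -
  let ?f = "\<lambda>(x1, x2, x3, x4). comb x1 x2 x3 x4"
  have inj: "inj ?f" by (auto simp: inj_def comb_eq_iff)
  have "card (range ?f) = CARD('a \<times> 'a \<times> 'a \<times> 'a)"
    by (rule card_image[OF inj])
  also have "\<dots> = CARD('a ^ 4)" by (simp add: power4_eq_xxxx)
  finally have "range ?f = UNIV" by (intro card_subset_eq) auto
  then have "v \<in> range ?f" by simp
  then show ?thesis using that by auto
qed

definition segre :: "'a \<times> 'a \<Rightarrow> 'a \<times> 'a \<Rightarrow> 'a ^ 4" where
  "segre s t = comb (fst s * fst t) (fst s * snd t) (snd s * fst t) (snd s * snd t)"

text \<open>Fixing one argument of the bilinear map leaves a line of the quadric. This lemma and the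
  next one describe the two rulings, the columns and the rows of the grid.\<close>

lemma segre_pencil1: "segre s t = pencil (pencil e1 e2 t) (pencil e3 e4 t) s"
  by (simp add: segre_def comb_def pencil_def vector_add_ldistrib algebra_simps)

lemma segre_pencil2: "segre s t = pencil (pencil e1 e3 s) (pencil e2 e4 s) t"
  by (simp add: segre_def comb_def pencil_def vector_add_ldistrib algebra_simps)

lemma Q_segre [simp]: "Q (segre s t) = 0"
  by (simp add: segre_def Q_comb)

text \<open>The polar form on the tensor product of two planes is, up to \<open>D\<close>, the
  product of their determinant forms. Hence two points of the quadric are orthogonal exactly when
  they share a row or a column.\<close>

lemma polar_segre: "polar Q (segre s t) (segre s' t') = D * cross s s' * cross t t'"
proof -
  have "polar Q (segre s t) (segre s' t') =
    fst s' * fst t' * polar Q (segre s t) e1 + fst s' * snd t' * polar Q (segre s t) e2 +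
    snd s' * fst t' * polar Q (segre s t) e3 + snd s' * snd t' * polar Q (segre s t) e4"
    by (simp add: segre_def[of s' t'] comb_def quadratic_map_polar_right[OF quad])
  then show ?thesis
    by (simp only: segre_def[of s t] polar_comb) (simp add: cross_def algebra_simps)
qed

lemma segre_nonzero:
  assumes "s \<in> line_points" "t \<in> line_points"
  shows "segre s t \<noteq> 0"
  using assms unfolding segre_def comb_zero[symmetric] comb_eq_iff by (auto simp: line_points_def)

text \<open>Isotropy says that the 2 by 2 matrix of coordinates has rank at most 1. The scalar is
  its first nonzero entry, which then forces the normalised factors.\<close>

lemma isotropic_segre:
  assumes "Q v = 0" "v \<noteq> 0"
  obtains s t c where "s \<in> line_points" "t \<in> line_points" "c \<noteq> 0" "v = c *s segre s t"
proof -
  obtain x1 x2 x3 x4 where v: "v = comb x1 x2 x3 x4" by (rule comb_surj)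
  have scale: "c *s segre s t = comb (c * (fst s * fst t)) (c * (fst s * snd t)) (c * (snd s * fst t)) (c * (snd s * snd t))"
    for c s t by (simp add: segre_def comb_def vector_add_ldistrib)
  have eq: "x1 * x4 = x2 * x3" using assms D by (simp add: v Q_comb)
  have lp: "(0, 1) \<in> line_points" "(1, a) \<in> line_points" for a :: 'a
    by (auto simp: line_points_def)
  show ?thesis
  proof (cases "x1 = 0")
    case False
    then have "v = x1 *s segre (1, x3 / x1) (1, x2 / x1)"
      using eq by (simp add: v scale comb_eq_iff field_simps)
    then show ?thesis using that lp False by blast
  next
    case x1: True
    show ?thesis
    proof (cases "x2 = 0")
      case False
      then have "v = x2 *s segre (1, x4 / x2) (0, 1)"
        using eq x1 by (simp add: v scale comb_eq_iff)
      then show ?thesis using that lp False by blast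
    next
      case x2: True
      show ?thesis
      proof (cases "x3 = 0")
        case False
        then have "v = x3 *s segre (0, 1) (1, x4 / x3)"
          using x1 x2 by (simp add: v scale comb_eq_iff)
        then show ?thesis using that lp False by blast
      next
        case True
        then have "v = x4 *s segre (0, 1) (0, 1)"
          using x1 x2 by (simp add: v scale comb_eq_iff)
        moreover have "x4 \<noteq> 0" using assms(2) x1 x2 True comb_zero by (auto simp: v)
        ultimately show ?thesis using that lp by blast
      qed
    qed
  qed
qed

definition quadric :: "('a ^ 4) set" where
  "quadric = {x \<in> points. Q x = 0}"

definition pt :: "'a \<times> 'a \<Rightarrow> 'a \<times> 'a \<Rightarrow> 'a ^ 4" where
  "pt s t = proj_point (segre s t)"

text \<open>Pairing with \<open>segre s' t''\<close> kills the right-hand side. If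
  \<open>t''\<close> is chosen with \<open>cross t t''\<close> nonzero, what remains is
  \<open>cross s s' = 0\<close>; the other factor is treated symmetrically.\<close>

lemma segre_proportional:
  assumes "s \<in> line_points" "t \<in> line_points" "s' \<in> line_points" "t' \<in> line_points"
    and "segre s t = c *s segre s' t'"
  shows "s = s' \<and> t = t'"
proof -
  have *: "cross s s'' * cross t t'' = c * (cross s' s'' * cross t' t'')" for s'' t''
  proof -
    have "polar Q (segre s t) (segre s'' t'') = c * polar Q (segre s' t') (segre s'' t'')"
      by (simp add: assms(5) quadratic_map_polar[OF quad])
    then have "D * (cross s s'' * cross t t'') = D * (c * (cross s' s'' * cross t' t''))"
      by (simp add: polar_segre algebra_simps)
    then show ?thesis using D by simp
  qed
  obtain t'' where "cross t t'' \<noteq> 0" using ex_cross_nonzero[OF assms(2)] by blast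
  then have "cross s s' = 0" using *[of s' t''] by simp
  moreover obtain s'' where "cross s s'' \<noteq> 0" using ex_cross_nonzero[OF assms(1)] by blast
  then have "cross t t' = 0" using *[of s'' t'] by simp
  ultimately show ?thesis using assms cross_eq_0 by blast
qed

lemma pt_inject:
  assumes "s \<in> line_points" "t \<in> line_points" "s' \<in> line_points" "t' \<in> line_points"
  shows "pt s t = pt s' t' \<longleftrightarrow> s = s' \<and> t = t'"
proof
  assume eq: "pt s t = pt s' t'"
  obtain c where c: "c \<noteq> 0" "pt s t = c *s segre s t"
    using proj_point(2)[OF segre_nonzero[OF assms(1,2)]] by (auto simp: pt_def)
  obtain c' where c': "pt s' t' = c' *s segre s' t'"
    using proj_point(2)[OF segre_nonzero[OF assms(3,4)]] by (auto simp: pt_def)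
  have "segre s t = inverse c *s pt s t" using c by simp
  then have "segre s t = (inverse c * c') *s segre s' t'"
    using eq c' by simp
  then show "s = s' \<and> t = t'" by (rule segre_proportional[OF assms])
qed simp

lemma bij_pt: "bij_betw (\<lambda>(s, t). pt s t) (line_points \<times> line_points) quadric"
  unfolding bij_betw_def
proof
  show "inj_on (\<lambda>(s, t). pt s t) (line_points \<times> line_points)"
    by (auto simp: inj_on_def pt_inject)
  show "(\<lambda>(s, t). pt s t) ` (line_points \<times> line_points) = quadric"
  proof
    show "(\<lambda>(s, t). pt s t) ` (line_points \<times> line_points) \<subseteq> quadric"
      by (auto simp: quadric_def pt_def proj_point segre_nonzero proj_point_zero_iff[OF quad])
    show "quadric \<subseteq> (\<lambda>(s, t). pt s t) ` (line_points \<times> line_points)"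
    proof
      fix x assume "x \<in> quadric"
      then have x: "x \<in> points" "Q x = 0" by (auto simp: quadric_def)
      obtain s t c where s: "s \<in> line_points" "t \<in> line_points" "x = c *s segre s t"
        using isotropic_segre[OF x(2) points_nonzero[OF x(1)]] by metis
      then have "x = pt s t" unfolding pt_def using proj_point_eqI[OF x(1)] by metis
      then show "x \<in> (\<lambda>(s, t). pt s t) ` (line_points \<times> line_points)" using s by auto
    qed
  qed
qed

lemma pt_in_quadric: "s \<in> line_points \<Longrightarrow> t \<in> line_points \<Longrightarrow> pt s t \<in> quadric"
  using bij_betwE[OF bij_pt] by auto

lemma quadricE:
  assumes "x \<in> quadric"
  obtains s t where "s \<in> line_points" "t \<in> line_points" "x = pt s t"
  using assms bij_betw_imp_surj_on[OF bij_pt] by fastforce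

lemma card_quadric_subset:
  assumes "\<And>s t. s \<in> line_points \<Longrightarrow> t \<in> line_points \<Longrightarrow> pt s t \<in> Y \<longleftrightarrow> P s t"
  shows "card (quadric \<inter> Y) = card {(s, t) \<in> line_points \<times> line_points. P s t}"
proof -
  have "quadric \<inter> Y = (\<lambda>(s, t). pt s t) ` {(s, t) \<in> line_points \<times> line_points. P s t}"
    by (force simp: image_iff assms pt_in_quadric elim: quadricE)
  moreover have "inj_on (\<lambda>(s, t). pt s t) {(s, t) \<in> line_points \<times> line_points. P s t}"
    by (rule inj_on_subset[OF bij_betw_imp_inj_on[OF bij_pt]]) auto
  ultimately show ?thesis by (simp add: card_image)
qed

lemma pt_zero_iff:
  assumes "quadratic_map f" "s \<in> line_points" "t \<in> line_points"
  shows "f (pt s t) = 0 \<longleftrightarrow> f (segre s t) = 0"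
  unfolding pt_def using assms by (intro proj_point_zero_iff segre_nonzero)

lemma card_nonzeros:
  assumes "quadratic_map f"
  shows "card {x \<in> quadric. f x \<noteq> 0} = card {(s, t) \<in> line_points \<times> line_points. f (segre s t) \<noteq> 0}"
  using card_quadric_subset[of "{x. f x \<noteq> 0}" "\<lambda>s t. f (segre s t) \<noteq> 0"] pt_zero_iff[OF assms]
  by (simp add: Int_def)

lemma
  assumes f: "quadratic_map f" and nz: "{x \<in> quadric. f x \<noteq> 0} \<noteq> {}"
  shows min_nonzeros: "(CARD('a) - 1)\<^sup>2 \<le> card {x \<in> quadric. f x \<noteq> 0}"
    and min_nonzeros_equality:
      "card {x \<in> quadric. f x \<noteq> 0} = (CARD('a) - 1)\<^sup>2 \<Longrightarrow> 3 \<le> CARD('a) \<Longrightarrow>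
        \<exists>S T. card S = CARD('a) - 1 \<and> card T = CARD('a) - 1 \<and> S \<subseteq> line_points \<and> T \<subseteq> line_points \<and>
          (\<forall>s\<in>line_points. \<forall>t\<in>line_points. f (segre s t) \<noteq> 0 \<longleftrightarrow> s \<in> S \<and> t \<in> T)"
proof -
  let ?B = "{(s, t) \<in> line_points \<times> line_points. f (segre s t) \<noteq> 0}"
  have fin: "finite ?B" by (rule finite_subset[of _ UNIV]) auto
  have "card {x \<in> quadric. f x \<noteq> 0} \<noteq> 0" using nz by (simp add: card_eq_0_iff)
  then have ne: "?B \<noteq> {}" unfolding card_nonzeros[OF f] by (metis card.empty)
  have cols: "CARD('a) - 1 \<le> card {s'. (s', t) \<in> ?B}" if "(s, t) \<in> ?B" for s t
    using card_pencil_nonzeros[OF f, of "pencil e1 e2 t" "pencil e3 e4 t" s] that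
    by (simp flip: segre_pencil1)
  have rows: "CARD('a) - 1 \<le> card {t'. (s, t') \<in> ?B}" if "(s, t) \<in> ?B" for s t
    using card_pencil_nonzeros[OF f, of "pencil e1 e3 s" "pencil e2 e4 s" t] that
    by (simp flip: segre_pencil2)
  show "(CARD('a) - 1)\<^sup>2 \<le> card {x \<in> quadric. f x \<noteq> 0}"
    unfolding card_nonzeros[OF f] by (rule grid_bound(1)[OF fin ne cols rows])
  assume "card {x \<in> quadric. f x \<noteq> 0} = (CARD('a) - 1)\<^sup>2" "3 \<le> CARD('a)"
  then have g: "?B = fst ` ?B \<times> snd ` ?B \<and> card (fst ` ?B) = CARD('a) - 1 \<and> card (snd ` ?B) = CARD('a) - 1"
    unfolding card_nonzeros[OF f] by (intro grid_bound(2)[OF fin ne cols rows]) (assumption | simp)+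
  define S T where "S = fst ` ?B" and "T = snd ` ?B"
  have B: "?B = S \<times> T" using g by (simp only: S_def T_def)
  have "f (segre s t) \<noteq> 0 \<longleftrightarrow> s \<in> S \<and> t \<in> T" if "s \<in> line_points" "t \<in> line_points" for s t
  proof -
    have "(s, t) \<in> ?B \<longleftrightarrow> (s, t) \<in> S \<times> T" unfolding B ..
    then show ?thesis using that by simp
  qed
  moreover have "S \<subseteq> line_points" "T \<subseteq> line_points" by (auto simp: S_def T_def)
  ultimately show "\<exists>S T. card S = CARD('a) - 1 \<and> card T = CARD('a) - 1 \<and> S \<subseteq> line_points \<and> T \<subseteq> line_points \<and>
          (\<forall>s\<in>line_points. \<forall>t\<in>line_points. f (segre s t) \<noteq> 0 \<longleftrightarrow> s \<in> S \<and> t \<in> T)"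
    using g unfolding S_def[symmetric] T_def[symmetric] by blast
qed

text \<open>The corners of a rectangle in the grid. Adjacent corners lie on a line of the quadric
  and are orthogonal; the two diagonals give the two nonzero pairings, of opposite sign.\<close>

lemma segre_frame:
  assumes "p \<in> line_points" "p' \<in> line_points" "r \<in> line_points" "r' \<in> line_points" "p \<noteq> p'" "r \<noteq> r'"
  shows "hyperbolic_frame Q (segre p r) (segre p r') (segre p' r) (segre p' r')
    (D * cross p p' * cross r r')"
proof
  show "D * cross p p' * cross r r' \<noteq> 0"
    using assms D cross_eq_0[of p p'] cross_eq_0[of r r'] by auto
  show "polar Q (segre p r') (segre p' r) = - (D * cross p p' * cross r r')"
    by (simp add: polar_segre) (simp add: cross_def algebra_simps)
qed (simp_all add: quad polar_segre)

text \<open>Carries statements about the tangent plane at \<open>e4\<close> over to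
  \<open>e1\<close>.\<close>

lemma swapped_frame: "hyperbolic_frame Q e4 e2 e3 e1 D"
  by unfold_locales (simp_all add: quad D isotropic gram gram')

end

section \<open>Tangent planes\<close>

lemma linear_form_exists:
  fixes g :: "'a::comm_ring_1 ^ 'n::finite \<Rightarrow> 'a"
  assumes add: "\<And>x y. g (x + y) = g x + g y" and scale: "\<And>c x. g (c *s x) = c * g x"
  obtains a where "\<And>v. eval_poly (linear_form a) v = g v"
proof -
  have zero: "g 0 = 0" using scale[of 0 0] by simp
  have sum: "g (sum h I) = (\<Sum>i\<in>I. g (h i))" for h :: "'n \<Rightarrow> 'a ^ 'n" and I
    by (induction I rule: infinite_finite_induct) (simp_all add: zero add)
  have "eval_poly (linear_form (\<chi> j. g (axis j 1))) v = g v" for v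
  proof -
    have "g v = g (\<Sum>j\<in>UNIV. v $ j *s axis j 1)" by (simp only: basis_expansion)
    also have "\<dots> = (\<Sum>j\<in>UNIV. v $ j * g (axis j 1))" by (simp only: sum scale)
    finally show ?thesis by (simp add: eval_linear_form mult.commute)
  qed
  then show ?thesis by (rule that)
qed

lemma pencil_pencil:
  "pencil (pencil u v r) (pencil u v r') s =
    pencil u v (fst s * fst r + snd s * fst r', fst s * snd r + snd s * snd r')"
  by (simp add: pencil_def vec_eq_iff algebra_simps)

text \<open>A line meets a plane, by the pigeonhole principle: \<open>F\<close> maps q^5 elements to
  q^4. The difference of a collision has a nonzero pencil parameter because \<open>B\<close> is
  injective, and scaling normalises it.\<close>

lemma pencil_meets_range:
  fixes B :: "'a::{field,finite} ^ 3 ^ 4"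
  assumes inj: "inj ((*v) B)"
  obtains s where "s \<in> line_points" "pencil u v s \<in> range ((*v) B)"
proof -
  define F where "F = (\<lambda>(y, s). B *v y - pencil u v s)"
  have "\<not> inj F"
  proof
    assume "inj F"
    then have "CARD(('a ^ 3) \<times> 'a \<times> 'a) \<le> CARD('a ^ 4)"
      by (intro card_inj_on_le[of F]) auto
    then have "CARD('a) ^ 5 \<le> CARD('a) ^ 4"
      by (simp add: eval_nat_numeral mult.assoc)
    moreover have "2 \<le> CARD('a)"
      using card_mono[of UNIV "{0, 1 :: 'a}"] by simp
    ultimately show False by (simp add: power_increasing_iff)
  qed
  then obtain y s y' s' where ne: "(y, s) \<noteq> (y', s')" and F: "F (y, s) = F (y', s')"
    unfolding inj_on_def by (metis surj_pair)
  define d where "d = (fst s - fst s', snd s - snd s')"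
  have eq: "pencil u v d = B *v (y - y')"
    using F by (simp add: F_def d_def pencil_def matrix_vector_mult_diff_distrib algebra_simps
        vector_sub_rdistrib)
  have "d \<noteq> (0, 0)"
  proof
    assume d: "d = (0, 0)"
    then have "B *v (y - y') = B *v 0" unfolding eq[symmetric] by (simp add: pencil_def)
    then have "y - y' = 0" using inj by (meson injD)
    with d ne show False by (auto simp: d_def prod_eq_iff)
  qed
  then obtain c t where t: "c \<noteq> 0" "t \<in> line_points" "d = (c * fst t, c * snd t)"
    by (rule line_points_representative)
  have "pencil u v t = inverse c *s pencil u v d"
    using t(1) by (simp add: t(3) pencil_scale)
  also have "\<dots> = B *v (inverse c *s (y - y'))"
    by (simp only: eq vector_scalar_commute)
  finally show ?thesis using that t(2) by blast
qed

context hyperbolic_frame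
begin

text \<open>The plane orthogonal to \<open>e4\<close> is spanned by \<open>e2\<close>,
  \<open>e3\<close>, \<open>e4\<close>. In these coordinates \<open>Q\<close> is -D y1 y2, which has
  the zeros of the rank 2 form \<open>g\<close>.\<close>

lemma tangent_plane_frame: "tangent_plane quadric {x \<in> points. polar Q x e4 = 0}"
proof -
  let ?S = "{x. polar Q x e4 = 0}"
  define B :: "'a ^ 3 ^ 4" where
    "B = (\<chi> i j. if j = 1 then e2 $ i else if j = 2 then e3 $ i else e4 $ i)"
  define g :: "(3, 'a) polyn" where "g = linear_form (axis 1 1) * linear_form (axis 2 1)"
  have B: "B *v y = comb 0 (y $ 1) (y $ 2) (y $ 3)" for y
    by (simp add: vec_eq_iff matrix_vector_mult_def B_def comb_def sum_3 algebra_simps)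
  have inj: "inj ((*v) B)"
    by (rule injI) (simp add: B comb_eq_iff vec_eq_iff[where 'b = 3] forall_3)
  have range: "range ((*v) B) = ?S"
  proof
    show "range ((*v) B) \<subseteq> ?S" by (auto simp: B polar_comb)
    show "?S \<subseteq> range ((*v) B)"
    proof
      fix x assume x: "x \<in> ?S"
      obtain x1 x2 x3 x4 where c: "x = comb x1 x2 x3 x4" by (rule comb_surj)
      then have "x1 = 0" using x D by (simp add: polar_comb)
      then have "x = B *v (vector [x2, x3, x4])" by (simp add: c B)
      then show "x \<in> range ((*v) B)" by blast
    qed
  qed
  have "vec.subspace ?S"
    using quadratic_map_polar(3)[OF quad, of 0 0 e4]
    by (auto simp: vec.subspace_def quadratic_map_polar[OF quad])
  moreover have "vec.dim ?S = 3"
  proof -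
    have "vec.dim (range ((*v) B)) = vec.dim (UNIV :: ('a ^ 3) set)"
      by (rule vec.dim_image_eq[OF matrix_vector_mul_linear_gen]) (use inj in \<open>simp add: inj_on_subset\<close>)
    then show ?thesis unfolding range vec_dim_card by simp
  qed
  moreover have P: "{x \<in> points. polar Q x e4 = 0} = points \<inter> ?S" by blast
  ultimately have "{x \<in> points. polar Q x e4 = 0} \<in> proj_planes"
    unfolding proj_planes_def by blast
  moreover have "g \<in> quadratic_forms" "form_rank g = 2"
    by (simp_all add: g_def linear_form_mult_quadratic form_rank_product)
  moreover have g: "eval_poly g y = y $ 1 * y $ 2" for y
    by (simp add: g_def eval_poly_mult)
  have "g \<noteq> 0"
    using g[of "vector [1, 1, 1]"] by auto
  moreover have "{x \<in> points. polar Q x e4 = 0} \<inter> quadric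
      = {B *v y | y. B *v y \<in> points \<and> eval_poly g y = 0}"
  proof -
    have "Q (B *v y) = 0 \<longleftrightarrow> eval_poly g y = 0" for y
      using D by (simp add: B Q_comb g)
    moreover have "{x \<in> points. polar Q x e4 = 0} = points \<inter> range ((*v) B)"
      by (simp only: P range)
    ultimately show ?thesis by (auto simp: quadric_def)
  qed
  ultimately show ?thesis
    unfolding tangent_plane_def using inj P range by blast
qed

text \<open>The planes orthogonal to \<open>e1\<close> and \<open>e4\<close> meet in the line
  through \<open>e2\<close> and \<open>e3\<close>, whose only points on the quadric are these two.
  The scalar \<kappa> allows the form to match a given codeword exactly, not only its
  support.\<close>

lemma two_tangent_planes_form:
  assumes "\<kappa> \<noteq> 0"
  obtains f where "f \<in> quadratic_forms" "f \<noteq> 0" "two_tangent_planes quadric (zero_set f)"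
    "\<And>x. eval_poly f x = \<kappa> * (polar Q x e1 * polar Q x e4)"
proof -
  obtain a where a: "\<And>x. eval_poly (linear_form a) x = \<kappa> * polar Q x e1"
    by (rule linear_form_exists[of "\<lambda>x. \<kappa> * polar Q x e1"])
      (auto simp: quadratic_map_polar[OF quad] algebra_simps)
  obtain b where b: "\<And>x. eval_poly (linear_form b) x = polar Q x e4"
    by (rule linear_form_exists[of "\<lambda>x. polar Q x e4"]) (auto simp: quadratic_map_polar[OF quad])
  define f where "f = linear_form a * linear_form b"
  have f: "eval_poly f x = \<kappa> * (polar Q x e1 * polar Q x e4)" for x
    by (simp add: f_def eval_poly_mult a b)
  let ?P1 = "{x \<in> points. polar Q x e1 = 0}" and ?P2 = "{x \<in> points. polar Q x e4 = 0}"
  have nz: "e1 \<noteq> 0" "e2 \<noteq> 0" "e3 \<noteq> 0"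
    using D gram gram' quadratic_map_polar(3)[OF quad, of 0 0] by auto
  have "tangent_plane quadric ?P1"
    using hyperbolic_frame.tangent_plane_frame[OF swapped_frame] .
  moreover have "tangent_plane quadric ?P2" by (rule tangent_plane_frame)
  moreover have "?P1 \<noteq> ?P2"
  proof -
    obtain c where c: "c \<noteq> 0" "proj_point e1 = c *s e1" using proj_point(2)[OF nz(1)] by blast
    have "polar Q (c *s e1) e1 = 0" "polar Q (c *s e1) e4 \<noteq> 0"
      using c D by (simp_all add: Q_simps)
    then show ?thesis using proj_point(1)[OF nz(1)] unfolding c(2) by blast
  qed
  moreover have "zero_set f = ?P1 \<union> ?P2"
    using assms by (auto simp: zero_set_def f)
  moreover have "card (?P1 \<inter> ?P2 \<inter> quadric) = 2"
  proof -
    have "?P1 \<inter> ?P2 \<inter> quadric = {proj_point e2, proj_point e3}"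
    proof
      show "?P1 \<inter> ?P2 \<inter> quadric \<subseteq> {proj_point e2, proj_point e3}"
      proof
        fix x assume "x \<in> ?P1 \<inter> ?P2 \<inter> quadric"
        then have x: "x \<in> points" "polar Q x e1 = 0" "polar Q x e4 = 0" "Q x = 0"
          by (auto simp: quadric_def)
        obtain x1 x2 x3 x4 where c: "x = comb x1 x2 x3 x4" by (rule comb_surj)
        then have x14: "x1 = 0" "x4 = 0" using x D by (simp_all add: polar_comb)
        then have "x2 = 0 \<or> x3 = 0" using x D by (simp add: c Q_comb)
        then have "x = x3 *s e3 \<or> x = x2 *s e2" using x14 by (auto simp: c comb_def)
        then show "x \<in> {proj_point e2, proj_point e3}"
          using proj_point_eqI[OF x(1), of x3 e3] proj_point_eqI[OF x(1), of x2 e2] by auto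
      qed
      obtain c d where c: "proj_point e2 = c *s e2" "proj_point e3 = d *s e3"
        using proj_point(2)[OF nz(2)] proj_point(2)[OF nz(3)] by blast
      have "polar Q (c *s e2) e1 = 0" "polar Q (c *s e2) e4 = 0" "Q (c *s e2) = 0"
        "polar Q (d *s e3) e1 = 0" "polar Q (d *s e3) e4 = 0" "Q (d *s e3) = 0"
        by (simp_all add: Q_simps gram')
      then show "{proj_point e2, proj_point e3} \<subseteq> ?P1 \<inter> ?P2 \<inter> quadric"
        using proj_point(1)[OF nz(2)] proj_point(1)[OF nz(3)] unfolding c quadric_def by blast
    qed
    moreover have "proj_point e2 \<noteq> proj_point e3"
    proof
      assume eq: "proj_point e2 = proj_point e3"
      obtain c d where c: "c \<noteq> 0" "proj_point e2 = c *s e2" "d \<noteq> 0" "proj_point e3 = d *s e3"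
        using proj_point(2)[OF nz(2)] proj_point(2)[OF nz(3)] by blast
      then have "comb 0 c 0 0 = comb 0 0 d 0" using eq by (simp add: comb_def)
      then show False using c by (simp add: comb_eq_iff)
    qed
    ultimately show ?thesis by simp
  qed
  ultimately have "two_tangent_planes quadric (zero_set f)"
    unfolding two_tangent_planes_def by blast
  moreover have "eval_poly f (e1 + e4) \<noteq> 0"
    using assms D by (simp add: f Q_simps gram')
  then have "f \<noteq> 0" by auto
  moreover have "f \<in> quadratic_forms" by (simp add: f_def linear_form_mult_quadratic)
  ultimately show ?thesis using that f by blast
qed

text \<open>The four pencils are the sides of the quadrilateral e1 e2 e4 e3. Vanishing there leaves
  only the coefficients of x1 x4 and x2 x3, and these two monomials agree on the quadric.\<close>

lemma restrict_to_quadric: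
  assumes f: "quadratic_map f"
    and v: "\<And>s. f (pencil e1 e2 s) = 0" "\<And>s. f (pencil e1 e3 s) = 0"
      "\<And>s. f (pencil e2 e4 s) = 0" "\<And>s. f (pencil e3 e4 s) = 0"
  obtains \<kappa> where "\<And>x. Q x = 0 \<Longrightarrow> f x = \<kappa> * (polar Q x e1 * polar Q x e4)"
proof -
  note fs = quadratic_map_polar[OF f] quadratic_map_polar_right[OF f] quadratic_map_add[of f]
  have zero: "f e1 = 0" "f e2 = 0" "f e3 = 0" "f e4 = 0"
    using v(1)[of "(1, 0)"] v(1)[of "(0, 1)"] v(4)[of "(1, 0)"] v(4)[of "(0, 1)"]
    by (simp_all add: pencil_def)
  have polar: "polar f e1 e2 = 0" "polar f e1 e3 = 0" "polar f e2 e4 = 0" "polar f e3 e4 = 0"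
    using v(1)[of "(1, 1)"] v(2)[of "(1, 1)"] v(3)[of "(1, 1)"] v(4)[of "(1, 1)"]
    by (simp_all add: quadratic_map_pencil[OF f] zero)
  \<comment> \<open>The product of the two pairings is D^2 x1 x4, hence the division by
    \<open>D * D\<close>.\<close>
  have "f x = (polar f e1 e4 + polar f e2 e3) / (D * D) * (polar Q x e1 * polar Q x e4)" if "Q x = 0" for x
  proof -
    obtain x1 x2 x3 x4 where c: "x = comb x1 x2 x3 x4" by (rule comb_surj)
    have eq: "x2 * x3 = x1 * x4" using that D by (simp add: c Q_comb)
    have "f x = x1 * x4 * polar f e1 e4 + x2 * x3 * polar f e2 e3"
      by (simp add: c comb_def fs zero polar algebra_simps)
    also have "\<dots> = (x1 * x4) * (polar f e1 e4 + polar f e2 e3)"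
      by (simp add: eq algebra_simps)
    finally show ?thesis using D by (simp add: c polar_comb)
  qed
  then show ?thesis by (rule that)
qed

lemma min_nonzeros_two_tangent_planes:
  assumes f: "quadratic_map f" and q: "3 \<le> CARD('a)"
    and card: "card {x \<in> quadric. f x \<noteq> 0} = (CARD('a) - 1)\<^sup>2"
  obtains h where "h \<in> quadratic_forms" "h \<noteq> 0" "two_tangent_planes quadric (zero_set h)"
    "\<And>x. x \<in> quadric \<Longrightarrow> eval_poly h x = f x"
proof -
  have "card {x \<in> quadric. f x \<noteq> 0} \<noteq> 0" using card q by simp
  then have ne: "{x \<in> quadric. f x \<noteq> 0} \<noteq> {}" by (metis card.empty)
  obtain S T where ST: "card S = CARD('a) - 1" "card T = CARD('a) - 1" "S \<subseteq> line_points" "T \<subseteq> line_points"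
    and nz: "\<And>s t. s \<in> line_points \<Longrightarrow> t \<in> line_points \<Longrightarrow> f (segre s t) \<noteq> 0 \<longleftrightarrow> s \<in> S \<and> t \<in> T"
    using min_nonzeros_equality[OF f ne card q] by blast
  have "card (line_points - S) = 2" "card (line_points - T) = 2"
    using ST q by (simp_all add: card_Diff_subset card_line_points)
  then obtain p p' r r' where pr: "line_points - S = {p, p'}" "p \<noteq> p'" "line_points - T = {r, r'}" "r \<noteq> r'"
    unfolding card_2_iff by blast
  then have lp: "p \<in> line_points" "p' \<in> line_points" "r \<in> line_points" "r' \<in> line_points"
    and notin: "p \<notin> S" "p' \<notin> S" "r \<notin> T" "r' \<notin> T" by blast+
  have card3: "3 \<le> card (line_points :: ('a \<times> 'a) set)" using q by (simp add: card_line_points)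
  \<comment> \<open>\<open>nz\<close> speaks of normalised parameters. The zeros must be extended to
    all pairs because \<open>pencil_pencil\<close> below produces parameters that are not
    normalised.\<close>
  have row: "f (pencil (pencil e1 e3 s) (pencil e2 e4 s) t) = 0" if "s \<in> line_points" "s \<notin> S" for s t
  proof (rule pencil_vanishes[OF f subset_refl card3])
    fix t' :: "'a \<times> 'a" assume "t' \<in> line_points"
    then show "f (pencil (pencil e1 e3 s) (pencil e2 e4 s) t') = 0"
      using nz[OF that(1)] that(2) by (simp flip: segre_pencil2)
  qed
  have col: "f (pencil (pencil e1 e2 t) (pencil e3 e4 t) s) = 0" if "t \<in> line_points" "t \<notin> T" for s t
  proof (rule pencil_vanishes[OF f subset_refl card3])
    fix s' :: "'a \<times> 'a" assume "s' \<in> line_points"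
    then show "f (pencil (pencil e1 e2 t) (pencil e3 e4 t) s') = 0"
      using nz[OF _ that(1)] that(2) by (simp flip: segre_pencil1)
  qed
  interpret F: hyperbolic_frame Q "segre p r" "segre p r'" "segre p' r" "segre p' r'" "D * cross p p' * cross r r'"
    using lp pr by (intro segre_frame) auto
  have "f (pencil (segre p r) (segre p r') s) = 0" "f (pencil (segre p' r) (segre p' r') s) = 0" for s
    unfolding segre_pencil2 pencil_pencil by (intro row lp notin)+
  moreover have "f (pencil (segre p r) (segre p' r) s) = 0" "f (pencil (segre p r') (segre p' r') s) = 0" for s
    unfolding segre_pencil1 pencil_pencil by (intro col lp notin)+
  ultimately obtain \<kappa> where \<kappa>: "\<And>x. Q x = 0 \<Longrightarrow> f x = \<kappa> * (polar Q x (segre p r) * polar Q x (segre p' r'))"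
    using F.restrict_to_quadric[OF f] by blast
  have "\<kappa> \<noteq> 0"
    using ne \<kappa> by (auto simp: quadric_def)
  then obtain h where h: "h \<in> quadratic_forms" "h \<noteq> 0" "two_tangent_planes quadric (zero_set h)"
    "\<And>x. eval_poly h x = \<kappa> * (polar Q x (segre p r) * polar Q x (segre p' r'))"
    using F.two_tangent_planes_form by blast
  then show ?thesis using that[OF h(1-3)] \<kappa> by (simp add: quadric_def)
qed

text \<open>Rank 2 in three variables gives a vertex, say at grid position (\<open>s0\<close>,
  \<open>t0\<close>). Adding the vertex to a point of the section stays in the section, so the point
  is orthogonal to the vertex and lies in row \<open>s0\<close> or column \<open>t0\<close>. The
  converse fills both lines, with (q + 1) + q points.\<close>

lemma card_tangent_plane:
  assumes "tangent_plane quadric P"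
  shows "card (quadric \<inter> P) = 2 * CARD('a) + 1"
proof -
  obtain B :: "'a ^ 3 ^ 4" and g where B: "inj ((*v) B)" "P = points \<inter> range ((*v) B)"
    and g: "g \<in> quadratic_forms" "form_rank g = 2"
    and PX: "P \<inter> quadric = {B *v y | y. B *v y \<in> points \<and> eval_poly g y = 0}"
    using assms unfolding tangent_plane_def by blast
  have qg: "quadratic_map (eval_poly g)" by (rule eval_poly_quadratic_map[OF g(1)])
  obtain e where e: "e \<noteq> 0" "\<And>x c. eval_poly g (x + c *s e) = eval_poly g x"
    using vertex_of_rank_less[of g] g(2) by auto
  have B0: "B *v y = 0 \<longleftrightarrow> y = 0" for y
    using injD[OF B(1), of y 0] by auto
  \<comment> \<open>\<open>PX\<close> compares zeros at normalised points only; homogeneity of both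
    forms extends this to every \<open>y\<close>.\<close>
  have zero_iff: "eval_poly g y = 0 \<longleftrightarrow> Q (B *v y) = 0" for y
  proof (cases "y = 0")
    case True
    then show ?thesis by (simp add: quadratic_map_zero[OF quad] quadratic_map_zero[OF qg])
  next
    case False
    then have nz: "B *v y \<noteq> 0" by (simp add: B0)
    obtain c where c: "c \<noteq> 0" "proj_point (B *v y) = c *s (B *v y)" using proj_point(2)[OF nz] by blast
    then have cy: "proj_point (B *v y) = B *v (c *s y)" by (simp add: vector_scalar_commute)
    have pts: "B *v (c *s y) \<in> points" using proj_point(1)[OF nz] by (simp only: cy)
    have "Q (B *v y) = 0 \<longleftrightarrow> B *v (c *s y) \<in> P \<inter> quadric"
      using proj_point_zero_iff[OF quad nz] pts unfolding cy B(2) quadric_def by auto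
    also have "\<dots> \<longleftrightarrow> eval_poly g (c *s y) = 0"
      unfolding PX using pts injD[OF B(1)] by blast
    also have "\<dots> \<longleftrightarrow> eval_poly g y = 0"
      using c by (simp add: quadratic_map_polar[OF qg])
    finally show ?thesis by simp
  qed
  have "eval_poly g e = 0" using e(2)[of 0 1] quadratic_map_zero[OF qg] by simp
  then obtain s0 t0 c where st: "s0 \<in> line_points" "t0 \<in> line_points" "c \<noteq> 0" "B *v e = c *s segre s0 t0"
    using isotropic_segre[of "B *v e"] zero_iff B0 e(1) by metis
  define W where "W = range ((*v) B)"
  have subW: "vec.subspace W"
    unfolding W_def by (intro vec.linear_subspace_image matrix_vector_mul_linear_gen vec.subspace_UNIV)
  have only: "s = s0 \<or> t = t0" if st': "s \<in> line_points" "t \<in> line_points" "segre s t \<in> W" for s t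
  proof -
    obtain y where y: "segre s t = B *v y" using st'(3) by (auto simp: W_def)
    have "eval_poly g y = 0" using zero_iff[of y] by (simp flip: y)
    then have "Q (B *v (y + 1 *s e)) = 0" using e(2)[of y 1] zero_iff[of "y + 1 *s e"] by simp
    then have "polar Q (segre s t) (c *s segre s0 t0) = 0"
      using \<open>eval_poly g e = 0\<close> zero_iff[of e]
      by (simp add: matrix_vector_right_distrib quadratic_map_add[of Q] y[symmetric] st(4))
    then have "cross s s0 = 0 \<or> cross t t0 = 0"
      using st(3) D by (simp add: quadratic_map_polar_right[OF quad] polar_segre)
    then show ?thesis using cross_eq_0 st' st by blast
  qed
  have vertexW: "segre s0 t0 \<in> W"
  proof -
    have "c *s segre s0 t0 \<in> W" unfolding W_def st(4)[symmetric] by blast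
    then have "inverse c *s (c *s segre s0 t0) \<in> W" by (rule vec.subspace_scale[OF subW])
    then show ?thesis using st(3) by simp
  qed
  have W_iff: "segre s t \<in> W \<longleftrightarrow> s = s0 \<or> t = t0" if st': "s \<in> line_points" "t \<in> line_points" for s t
  proof
    assume "s = s0 \<or> t = t0"
    \<comment> \<open>The line of all \<open>segre s' t\<close> meets the plane somewhere, and for
      \<open>t\<close> different from \<open>t0\<close> the fact \<open>only\<close> leaves just
      \<open>s' = s0\<close>.\<close>
    moreover have "segre s0 t \<in> W"
    proof (cases "t = t0")
      case False
      obtain s' where s': "s' \<in> line_points" "segre s' t \<in> W"
        unfolding segre_pencil1 W_def by (rule pencil_meets_range[OF B(1)])
      with False only st' show ?thesis by blast
    qed (simp add: vertexW)
    moreover have "segre s t0 \<in> W"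
    proof (cases "s = s0")
      case False
      obtain t' where t': "t' \<in> line_points" "segre s t' \<in> W"
        unfolding segre_pencil2 W_def by (rule pencil_meets_range[OF B(1)])
      with False only st' show ?thesis by blast
    qed (simp add: vertexW)
    ultimately show "segre s t \<in> W" by blast
  qed (rule only[OF st'])
  have "pt s t \<in> P \<longleftrightarrow> s = s0 \<or> t = t0" if st': "s \<in> line_points" "t \<in> line_points" for s t
    using proj_point_mem_subspace_iff[OF subW segre_nonzero[OF st']] proj_point(1)[OF segre_nonzero[OF st']]
      W_iff[OF st'] unfolding B(2) W_def pt_def by blast
  then have "card (quadric \<inter> P) = card {(s, t) \<in> line_points \<times> line_points. s = s0 \<or> t = t0}"
    by (rule card_quadric_subset)
  also have "{(s, t) \<in> line_points \<times> line_points. s = s0 \<or> t = t0}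
      = {s0} \<times> line_points \<union> (line_points - {s0}) \<times> {t0}"
    using st by auto
  also have "card \<dots> = card ({s0} \<times> (line_points :: ('a \<times> 'a) set)) + card ((line_points - {s0}) \<times> {t0})"
    by (rule card_Un_disjoint) auto
  also have "\<dots> = 2 * CARD('a) + 1"
    using st by (simp add: card_cartesian_product card_line_points)
  finally show ?thesis .
qed

end

section \<open>Lines and minimum weight\<close>

text \<open>The inequality of arithmetic and geometric means. The detour through integers avoids
  truncated subtraction in the square of x - y.\<close>

lemma mult_le_square_of_sum_le:
  fixes x y m :: nat
  assumes "x + y \<le> 2 * m"
  shows "x * y \<le> m\<^sup>2"
proof -
  have "(x + y)\<^sup>2 \<le> (2 * m)\<^sup>2" using assms by (rule power_mono) simp
  moreover have "4 * (int x * int y) \<le> (int x + int y)\<^sup>2"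
    using zero_le_power2[of "int x - int y"] by (simp add: power2_eq_square algebra_simps)
  then have "4 * (x * y) \<le> (x + y)\<^sup>2"
    by (metis (mono_tags, lifting) of_nat_add of_nat_le_iff of_nat_mult of_nat_numeral of_nat_power)
  ultimately show ?thesis by (simp add: power2_eq_square)
qed

context hyperbolic_frame
begin

lemma card_quadric: "card quadric = (CARD('a) + 1)\<^sup>2"
  using bij_betw_same_card[OF bij_pt] by (simp add: card_cartesian_product card_line_points power2_eq_square)

lemma finite_quadric: "finite quadric"
  by (rule finite_subset[of _ UNIV]) auto

lemma two_tangent_planes_nonzeros:
  assumes "two_tangent_planes quadric (zero_set f)"
  shows "card {x \<in> quadric. eval_poly f x \<noteq> 0} = (CARD('a) - 1)\<^sup>2"
proof -
  obtain P1 P2 where P: "tangent_plane quadric P1" "tangent_plane quadric P2"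
    "zero_set f = P1 \<union> P2" "card (P1 \<inter> P2 \<inter> quadric) = 2"
    using assms unfolding two_tangent_planes_def by blast
  have fin: "finite (quadric \<inter> P1)" "finite (quadric \<inter> P2)" using finite_quadric by auto
  have "(quadric \<inter> P1) \<inter> (quadric \<inter> P2) = P1 \<inter> P2 \<inter> quadric" by blast
  \<comment> \<open>The sections have 2q + 1 points each and share 2, so 4q points are zeros, and (q
    + 1)^2 - 4q = (q - 1)^2.\<close>
  then have "card ((quadric \<inter> P1) \<union> (quadric \<inter> P2)) + 2 = 2 * (2 * CARD('a) + 1)"
    using card_Un_Int[OF fin] P by (simp add: card_tangent_plane)
  moreover have "{x \<in> quadric. eval_poly f x \<noteq> 0} = quadric - ((quadric \<inter> P1) \<union> (quadric \<inter> P2))"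
  proof -
    have "x \<in> P1 \<union> P2 \<longleftrightarrow> eval_poly f x = 0" if "x \<in> quadric" for x
      using that unfolding P(3)[symmetric] by (simp add: zero_set_def quadric_def)
    then show ?thesis by blast
  qed
  moreover have "card (quadric - ((quadric \<inter> P1) \<union> (quadric \<inter> P2)))
      = card quadric - card ((quadric \<inter> P1) \<union> (quadric \<inter> P2))"
    by (rule card_Diff_subset) (use fin in auto)
  ultimately have "card {x \<in> quadric. eval_poly f x \<noteq> 0} = (CARD('a) + 1)\<^sup>2 - 4 * CARD('a)"
    by (simp add: card_quadric)
  also have "\<dots> = (CARD('a) - 1)\<^sup>2"
  proof -
    obtain k where "CARD('a) = Suc k"
      using zero_less_card_finite[where 'a = 'a] by (metis gr0_conv_Suc)
    then show ?thesis by (simp add: power2_eq_square algebra_simps)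
  qed
  finally show ?thesis .
qed

lemma polar_pt:
  assumes "s \<in> line_points" "t \<in> line_points" "s' \<in> line_points" "t' \<in> line_points"
    and "polar Q (pt s t) (pt s' t') = 0"
  shows "s = s' \<or> t = t'"
proof -
  obtain c c' where c: "c \<noteq> 0" "pt s t = c *s segre s t" "c' \<noteq> 0" "pt s' t' = c' *s segre s' t'"
    using proj_point(2)[OF segre_nonzero[OF assms(1,2)]] proj_point(2)[OF segre_nonzero[OF assms(3,4)]]
    unfolding pt_def by blast
  have "cross s s' = 0 \<or> cross t t' = 0"
    using assms(5) D c(1,3) unfolding c(2,4)
    by (simp add: quadratic_map_polar[OF quad] quadratic_map_polar_right[OF quad] polar_segre)
  then show ?thesis using cross_eq_0 assms by blast
qed

text \<open>\<open>Q\<close>, and with it the polar form, vanishes on the subspace of the line, so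
  any two of its points share a row or a column. Two distinct points decide which of the two it is,
  and all other points must follow.\<close>

lemma line_in_quadric:
  assumes l: "l \<in> proj_lines" "l \<subseteq> quadric"
  shows "l \<in> (\<lambda>s. pt s ` line_points) ` line_points \<union> (\<lambda>t. (\<lambda>s. pt s t) ` line_points) ` line_points"
proof -
  obtain S where S: "l = points \<inter> S" "vec.subspace S" "vec.dim S = 2"
    using l(1) unfolding proj_lines_def by blast
  have not_span: "\<not> S \<subseteq> vec.span {x}" for x
    using vec.dim_le_card[of S "{x}"] S(3) by auto
  have proj: "proj_point z \<in> l" if "z \<in> S" "z \<noteq> 0" for z
    using that proj_point(1)[OF that(2)] proj_point_mem_subspace_iff[OF S(2) that(2)] by (simp add: S(1))
  have QS: "Q z = 0" if "z \<in> S" for z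
  proof (cases "z = 0")
    case False
    then show ?thesis
      using proj[OF that False] l(2) proj_point_zero_iff[OF quad False] by (auto simp: quadric_def)
  qed (simp add: quadratic_map_zero[OF quad])
  have polS: "polar Q x y = 0" if "x \<in> S" "y \<in> S" for x y
    using QS[OF that(1)] QS[OF that(2)] QS[OF vec.subspace_add[OF S(2) that]] by (simp add: polar_def)
  obtain y where y: "y \<in> S" "y \<noteq> 0"
    using not_span[of 0] by (metis vec.span_zero subsetI)
  define x where "x = proj_point y"
  obtain z where z: "z \<in> S" "z \<notin> vec.span {x}" using not_span by blast
  then have "z \<noteq> 0" using vec.span_zero by metis
  have x': "proj_point z \<noteq> x"
  proof
    assume "proj_point z = x"
    moreover obtain c where "c \<noteq> 0" "proj_point z = c *s z" using proj_point(2)[OF \<open>z \<noteq> 0\<close>] by blast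
    ultimately have "z = inverse c *s x" by auto
    then show False using z(2) vec.span_scale[OF vec.span_base[of x "{x}"]] by simp
  qed
  have xl: "x \<in> l" "proj_point z \<in> l" using proj y z \<open>z \<noteq> 0\<close> by (simp_all add: x_def)
  then obtain s t s' t' where st: "s \<in> line_points" "t \<in> line_points" "s' \<in> line_points" "t' \<in> line_points"
    "x = pt s t" "proj_point z = pt s' t'"
    using l(2) quadricE by (metis subsetD)
  have segS: "segre s t \<in> S" if "s \<in> line_points" "t \<in> line_points" "pt s t \<in> l" for s t
    using that proj_point_mem_subspace_iff[OF S(2) segre_nonzero[OF that(1,2)]] by (simp add: S(1) pt_def)
  have ptl: "pt s t \<in> l" if "s \<in> line_points" "t \<in> line_points" "segre s t \<in> S" for s t
    using proj[OF that(3) segre_nonzero[OF that(1,2)]] by (simp add: pt_def)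
  have pencilS: "pencil u v r \<in> S" if "u \<in> S" "v \<in> S" for u v r
    unfolding pencil_def using that by (intro vec.subspace_add[OF S(2)] vec.subspace_scale[OF S(2)])
  have segs: "segre s t \<in> S" "segre s' t' \<in> S" using segS st xl by auto
  have rel: "a = a' \<or> b = b'"
    if "pt a b \<in> l" "pt a' b' \<in> l" "a \<in> line_points" "b \<in> line_points" "a' \<in> line_points" "b' \<in> line_points"
    for a b a' b'
    using polar_pt polS that by (auto simp: S(1))
  have elt: "\<exists>a b. a \<in> line_points \<and> b \<in> line_points \<and> w = pt a b" if "w \<in> l" for w
    using that l(2) quadricE by blast
  have "s = s' \<or> t = t'" using rel st xl by simp
  then show ?thesis
  proof
    assume s: "s = s'"
    then have t: "t \<noteq> t'" using x' st by auto
    then have nz: "cross t t' \<noteq> 0" using cross_eq_0 st by blast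
    have "l = pt s ` line_points"
    proof
      show "l \<subseteq> pt s ` line_points"
      proof
        fix w assume w: "w \<in> l"
        then obtain a b where ab: "a \<in> line_points" "b \<in> line_points" "w = pt a b" using elt by blast
        \<comment> \<open>Comparison with both chosen points: outside row \<open>s\<close>,
          \<open>b\<close> would have to equal the distinct \<open>t\<close> and
          \<open>t'\<close>.\<close>
        have "a = s \<or> b = t" "a = s \<or> b = t'"
          using rel[of a b s t] rel[of a b s' t'] w ab xl st s by auto
        then show "w \<in> pt s ` line_points" using t ab by auto
      qed
      show "pt s ` line_points \<subseteq> l"
      proof clarify
        fix b b' :: 'a assume b: "(b, b') \<in> line_points"
        have "segre s (b, b') \<in> S"
          using pencilS segs s unfolding segre_pencil2 pencil_basis_change[OF nz, of _ _ "(b, b')"] by blast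
        then show "pt s (b, b') \<in> l" using ptl st b by blast
      qed
    qed
    then show ?thesis using st by blast
  next
    assume t: "t = t'"
    then have s: "s \<noteq> s'" using x' st by auto
    then have nz: "cross s s' \<noteq> 0" using cross_eq_0 st by blast
    have "l = (\<lambda>a. pt a t) ` line_points"
    proof
      show "l \<subseteq> (\<lambda>a. pt a t) ` line_points"
      proof
        fix w assume w: "w \<in> l"
        then obtain a b where ab: "a \<in> line_points" "b \<in> line_points" "w = pt a b" using elt by blast
        have "a = s \<or> b = t" "a = s' \<or> b = t"
          using rel[of a b s t] rel[of a b s' t'] w ab xl st t by auto
        then show "w \<in> (\<lambda>a. pt a t) ` line_points" using s ab by auto
      qed
      show "(\<lambda>a. pt a t) ` line_points \<subseteq> l"
      proof clarify
        fix a a' :: 'a assume a: "(a, a') \<in> line_points"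
        have "segre (a, a') t \<in> S"
          using pencilS segs t unfolding segre_pencil1 pencil_basis_change[OF nz, of _ _ "(a, a')"] by blast
        then show "pt (a, a') t \<in> l" using ptl st a by blast
      qed
    qed
    then show ?thesis using st by blast
  qed
qed

text \<open>The zeros contain |S| rows and |T| columns with |S| + |T| >= 4. The support lies in the
  remaining grid, and the product of its side lengths is largest when they are equal. The lower
  bound holds as soon as the codeword is nonzero.\<close>

lemma four_lines_nonzeros:
  assumes f: "f \<in> quadratic_forms" and q: "3 \<le> CARD('a)"
    and Y: "hyperbolic_four_lines quadric (zero_set f)"
  shows "card {x \<in> quadric. eval_poly f x \<noteq> 0} = (CARD('a) - 1)\<^sup>2"
proof (rule antisym)
  let ?row = "\<lambda>s. pt s ` line_points" and ?col = "\<lambda>t. (\<lambda>s. pt s t) ` line_points"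
  let ?Y = "zero_set f"
  have qf: "quadratic_map (eval_poly f)" by (rule eval_poly_quadratic_map[OF f])
  define S where "S = {s \<in> line_points. ?row s \<subseteq> ?Y}"
  define T where "T = {t \<in> line_points. ?col t \<subseteq> ?Y}"
  have fin: "finite A" for A :: "('a \<times> 'a) set" by (rule finite_subset[of _ UNIV]) auto
  have "{l \<in> proj_lines. l \<subseteq> quadric \<and> l \<subseteq> ?Y} \<subseteq> ?row ` S \<union> ?col ` T"
    using line_in_quadric unfolding S_def T_def by blast
  then have "card {l \<in> proj_lines. l \<subseteq> quadric \<and> l \<subseteq> ?Y} \<le> card (?row ` S \<union> ?col ` T)"
    by (rule card_mono[rotated]) (use fin in auto)
  also have "\<dots> \<le> card (?row ` S) + card (?col ` T)" by (rule card_Un_le)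
  also have "\<dots> \<le> card S + card T" by (intro add_mono card_image_le fin)
  finally have four: "4 \<le> card S + card T"
    using Y unfolding hyperbolic_four_lines_def by simp
  \<comment> \<open>Keeps the natural subtractions in the side lengths of the remaining grid
    exact.\<close>
  have ST: "card S \<le> CARD('a) + 1" "card T \<le> CARD('a) + 1"
    unfolding card_line_points[symmetric] S_def T_def by (rule card_mono[OF fin], blast)+
  have "{(s, t) \<in> line_points \<times> line_points. eval_poly f (segre s t) \<noteq> 0} \<subseteq> (line_points - S) \<times> (line_points - T)"
  proof clarify
    fix a b c d :: 'a
    assume lp: "(a, b) \<in> line_points" "(c, d) \<in> line_points" and nz: "eval_poly f (segre (a, b) (c, d)) \<noteq> 0"
    have "eval_poly f (pt (a, b) (c, d)) \<noteq> 0" using pt_zero_iff[OF qf lp] nz by simp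
    then have "pt (a, b) (c, d) \<notin> ?Y" by (simp add: zero_set_def)
    then show "(a, b) \<in> line_points - S \<and> (c, d) \<in> line_points - T" using lp unfolding S_def T_def by blast
  qed
  then have "card {x \<in> quadric. eval_poly f x \<noteq> 0} \<le> card ((line_points - S) \<times> (line_points - T))"
    unfolding card_nonzeros[OF qf] by (rule card_mono[rotated]) (simp add: fin)
  also have "\<dots> = (CARD('a) + 1 - card S) * (CARD('a) + 1 - card T)"
    unfolding card_cartesian_product card_line_points[symmetric]
    by (intro arg_cong2[of _ _ _ _ "(*)"] card_Diff_subset fin) (auto simp: S_def T_def)
  also have "\<dots> \<le> (CARD('a) - 1)\<^sup>2"
    by (rule mult_le_square_of_sum_le) (use four ST q in linarith)
  finally show "card {x \<in> quadric. eval_poly f x \<noteq> 0} \<le> (CARD('a) - 1)\<^sup>2" .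
  \<comment> \<open>Otherwise every line of \<open>R1\<close> would lie in the zero set, so
    \<open>R1\<close> would have two lines. With q + 1 points each they cannot cover (q + 1)^2
    points.\<close>
  have "\<not> quadric \<subseteq> ?Y"
  proof
    assume sub: "quadric \<subseteq> ?Y"
    obtain R1 R2 where R: "reguli_of quadric R1 R2" "card {l \<in> R1. l \<subseteq> ?Y} = 2"
      using Y unfolding hyperbolic_four_lines_def by blast
    have cover: "\<Union>R1 = quadric" and lines: "R1 \<subseteq> proj_lines"
      using R(1) unfolding reguli_of_def by blast+
    have "{l \<in> R1. l \<subseteq> ?Y} = R1" using sub cover by blast
    then have c2: "card R1 = 2" using R(2) by simp
    have "card l \<le> CARD('a) + 1" if "l \<in> R1" for l
    proof -
      have "l \<in> ?row ` line_points \<union> ?col ` line_points"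
        using that lines cover by (intro line_in_quadric) blast+
      then show ?thesis
        unfolding card_line_points[symmetric] by (auto intro: card_image_le[OF fin])
    qed
    then have "card (\<Union>R1) \<le> (\<Sum>l\<in>R1. CARD('a) + 1)"
      by (intro order_trans[OF card_Union_le_sum_card] sum_mono)
    then have "(CARD('a) + 1)\<^sup>2 \<le> 2 * (CARD('a) + 1)"
      by (simp add: cover card_quadric c2)
    then have "CARD('a) + 1 \<le> 2"
      unfolding power2_eq_square by (subst (asm) mult_le_cancel2) simp
    with q show False by simp
  qed
  then have "{x \<in> quadric. eval_poly f x \<noteq> 0} \<noteq> {}"
    by (auto simp: zero_set_def quadric_def)
  then show "(CARD('a) - 1)\<^sup>2 \<le> card {x \<in> quadric. eval_poly f x \<noteq> 0}"
    by (rule min_nonzeros[OF qf])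
qed

section \<open>Minimum weight and its codewords\<close>

lemma weight_codeword: "weight quadric (codeword quadric f) = card {x \<in> quadric. eval_poly f x \<noteq> 0}"
  unfolding weight_def codeword_def by (rule arg_cong[of _ _ card]) auto

lemma min_weight_quadric:
  assumes "3 \<le> CARD('a)"
  shows "min_weight quadric = (CARD('a) - 1)\<^sup>2"
  unfolding min_weight_def
proof (rule Least_equality)
  obtain h where h: "h \<in> quadratic_forms" "two_tangent_planes quadric (zero_set h)"
    using two_tangent_planes_form[of 1] by auto
  then have "weight quadric (codeword quadric h) = (CARD('a) - 1)\<^sup>2"
    by (simp only: weight_codeword two_tangent_planes_nonzeros)
  then show "(CARD('a) - 1)\<^sup>2 \<noteq> 0 \<and> (\<exists>w\<in>functional_code quadric. weight quadric w = (CARD('a) - 1)\<^sup>2)"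
    using assms h(1) by (auto simp: functional_code_def)
next
  fix d assume "d \<noteq> 0 \<and> (\<exists>w\<in>functional_code quadric. weight quadric w = d)"
  then obtain f where f: "f \<in> quadratic_forms" "d = card {x \<in> quadric. eval_poly f x \<noteq> 0}" "d \<noteq> 0"
    unfolding functional_code_def weight_codeword[symmetric] by blast
  then have "{x \<in> quadric. eval_poly f x \<noteq> 0} \<noteq> {}" by (metis card.empty)
  then show "(CARD('a) - 1)\<^sup>2 \<le> d"
    using min_nonzeros[OF eval_poly_quadratic_map[OF f(1)]] f(2) by simp
qed

lemma minimum_weight_codewords:
  assumes q: "3 \<le> CARD('a)" and w: "w \<in> functional_code quadric"
  shows "weight quadric w = min_weight quadric \<longleftrightarrow>
    (\<exists>f \<in> quadratic_forms. f \<noteq> 0 \<and> w = codeword quadric f \<and>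
       (two_tangent_planes quadric (zero_set f) \<or> hyperbolic_four_lines quadric (zero_set f)))"
proof
  assume min: "weight quadric w = min_weight quadric"
  obtain f where f: "f \<in> quadratic_forms" "w = codeword quadric f"
    using w by (auto simp: functional_code_def)
  have "card {x \<in> quadric. eval_poly f x \<noteq> 0} = (CARD('a) - 1)\<^sup>2"
    using min by (simp only: f(2) weight_codeword min_weight_quadric[OF q])
  then obtain h where h: "h \<in> quadratic_forms" "h \<noteq> 0" "two_tangent_planes quadric (zero_set h)"
    "\<And>x. x \<in> quadric \<Longrightarrow> eval_poly h x = eval_poly f x"
    using min_nonzeros_two_tangent_planes[OF eval_poly_quadratic_map[OF f(1)] q] by blast
  have "w = codeword quadric h"
    unfolding f(2) codeword_def by (rule restrict_ext) (simp add: h(4))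
  with h show "\<exists>f \<in> quadratic_forms. f \<noteq> 0 \<and> w = codeword quadric f \<and>
       (two_tangent_planes quadric (zero_set f) \<or> hyperbolic_four_lines quadric (zero_set f))"
    by blast
next
  assume "\<exists>f \<in> quadratic_forms. f \<noteq> 0 \<and> w = codeword quadric f \<and>
       (two_tangent_planes quadric (zero_set f) \<or> hyperbolic_four_lines quadric (zero_set f))"
  then show "weight quadric w = min_weight quadric"
    using two_tangent_planes_nonzeros four_lines_nonzeros[OF _ q]
    by (auto simp: weight_codeword min_weight_quadric[OF q])
qed

end

theorem theorem6p3:
  fixes X :: "('a::{field,finite} ^ 4) set"
  assumes "CARD('a) \<ge> 3"
    and "hyperbolic_quadric X"
  shows "\<forall>w \<in> functional_code X.
    weight X w = min_weight X \<longleftrightarrow>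
    (\<exists>f \<in> quadratic_forms. f \<noteq> 0 \<and> w = codeword X f \<and>
       (two_tangent_planes X (zero_set f) \<or> hyperbolic_four_lines X (zero_set f)))"
proof -
  obtain f where f: "f \<in> quadratic_forms" "form_rank f = 4" "X = zero_set f"
    and card: "card X = (CARD('a) + 1)\<^sup>2"
    using assms(2) unfolding hyperbolic_quadric_def by blast
  have X: "X = {x \<in> points. eval_poly f x = 0}" by (simp add: f(3) zero_set_def)
  obtain e1 e2 e3 e4 where frame: "hyperbolic_frame (eval_poly f) e1 e2 e3 e4 1"
  \<comment> \<open>The rank supplies nondegeneracy, and the number of points excludes the elliptic
    case.\<close>
  proof (rule hyperbolic_frame_exists[OF eval_poly_quadratic_map[OF f(1)] _ card[unfolded X]])
    fix v assume "eval_poly f v = 0" "\<And>x. polar (eval_poly f) x v = 0"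
    then show "v = 0" by (intro nondegenerate_of_full_rank[OF f(1)]) (simp_all add: f(2))
  qed
  have "hyperbolic_frame.quadric (eval_poly f) = X"
    by (simp add: hyperbolic_frame.quadric_def[OF frame] X)
  then show ?thesis
    using hyperbolic_frame.minimum_weight_codewords[OF frame assms(1)] by simp
qed

end
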